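(* Let $\mathbb{R}^n$, $n\ge 1$, be the configuration space. There exist potentials $V$ on $\mathbb{R}^n$ which are negative, homogeneous of degree $-\alpha$ for some $\alpha>0$, and smooth away from $0$, for which the JM-Marchal lemma at energy $0$ fails, and hence for which the Marchal lemma fails.
   Context: Setting. Configuration space is a Euclidean vector space $\mathbb{R}^n$ with a potential $V=-U$, where $U:\mathbb{R}^n\to(0,\infty]$ is continuous. A collision point is a point $p\in\mathbb{R}^n$ with $U(p)=\infty$ (for the potentials in the claim this is only the origin). Homogeneous of degree $-\alpha$ means $V(\lambda q)=\lambda^{-\alpha}V(q)$ for $\lambda>0$, $q\ne0$. The Lagrangian is $L(q,\dot q)=\frac12|\dot q|^2+U(q)$, and the action of an absolutely continuous path $c$ is $A(c)=\int_c L\,dt\in[0,\infty]$. An interior collision point of a path is a collision point along the path which is not one of the path's endpoints. Fixed endpoint, fixed time action minimization problem: given $q_0,q_1\in\mathbb{R}^n$ and $T>0$, minimize $\int_c L\,dt$ over all (absolutely continuous) paths $c$ joining $q_0$ to $q_1$ in time $T$. A minimizer is understood to have finite action. The Marchal lemma holds for $V$ if, for every choice of $q_0,q_1\in\mathbb{R}^n$ and $T>0$, every minimizer of the fixed endpoint, fixed time action minimization problem has no interior collision points. It fails otherwise. Zero-energy Jacobi-Maupertuis (JM) length. The JM length at energy $0$ of an absolutely continuous curve $c$ in $\mathbb{R}^n$ is $\ell(c)=\int_c\sqrt{2U(q)}\,|dq|\in[0,\infty]$. A curve $c$ joining $p$ to $q$ is a minimizing JM geodesic for energy $0$ if $\ell(c)<\infty$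 and $\ell(c)\le\ell(\sigma)$ for every absolutely continuous curve $\sigma$ joining $p$ to $q$. The JM-Marchal lemma holds for $V$ at energy $0$ if no minimizing JM geodesic for energy $0$ has an interior collision point. It fails otherwise. *)

theory Defs
  imports "HOL-Analysis.Analysis"
begin

subsection \<open>Smooth functions\<close>

text \<open>On an open set \<open>S\<close> this is the usual notion of being \<open>k\<close> times continuously
  differentiable: all iterated directional derivatives up to order \<open>k\<close> exist and are continuous.\<close>

fun Ck_on :: "nat \<Rightarrow> 'a::real_normed_vector set \<Rightarrow> ('a \<Rightarrow> 'b::real_normed_vector) \<Rightarrow> bool" where
  "Ck_on 0 S f \<longleftrightarrow> continuous_on S f"
| "Ck_on (Suc k) S f \<longleftrightarrow>
     (\<forall>x\<in>S. f differentiable (at x)) \<and>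
     (\<forall>v. Ck_on k S (\<lambda>x. frechet_derivative f (at x) v))"

definition smooth_on :: "'a::real_normed_vector set \<Rightarrow> ('a \<Rightarrow> 'b::real_normed_vector) \<Rightarrow> bool" where
  "smooth_on S f \<longleftrightarrow> (\<forall>k. Ck_on k S f)"

subsection \<open>Absolutely continuous curves\<close>

text \<open>The members of \<open>D\<close> are finitely many non-overlapping compact intervals
  \<open>I = {s..t}\<close> with \<open>Inf I = s\<close> and \<open>Sup I = t\<close>.\<close>

definition abs_continuous_curve :: "real \<Rightarrow> real \<Rightarrow> (real \<Rightarrow> 'a::real_normed_vector) \<Rightarrow> bool" where
  "abs_continuous_curve a b c \<longleftrightarrow>
     (\<forall>\<epsilon>>0. \<exists>\<delta>>0. \<forall>D. D division_of \<Union>D \<and> \<Union>D \<subseteq> {a..b} \<and> (\<Sum>I\<in>D. Sup I - Inf I) < \<delta>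
        \<longrightarrow> (\<Sum>I\<in>D. norm (c (Sup I) - c (Inf I))) < \<epsilon>)"

subsection \<open>Potentials and collisions\<close>

text \<open>A potential \<open>V = - U\<close> takes values in the extended reals; \<open>neg_potential V\<close> is \<open>U\<close>.
  For negative \<open>V\<close> no information is lost by passing to \<^typ>\<open>ennreal\<close>.\<close>

definition neg_potential :: "('a \<Rightarrow> ereal) \<Rightarrow> 'a \<Rightarrow> ennreal" where
  "neg_potential V q = e2ennreal (- V q)"

definition collision_point :: "('a \<Rightarrow> ereal) \<Rightarrow> 'a \<Rightarrow> bool" where
  "collision_point V p \<longleftrightarrow> neg_potential V p = \<infinity>"

text \<open>An interior collision point is required to differ from the two end points as a point of
  configuration space, not only as a parameter value. Otherwise a curve resting at a collision would
  have interior collisions.\<close>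

definition interior_collision_point ::
    "('a \<Rightarrow> ereal) \<Rightarrow> real \<Rightarrow> real \<Rightarrow> (real \<Rightarrow> 'a) \<Rightarrow> 'a \<Rightarrow> bool" where
  "interior_collision_point V a b c p \<longleftrightarrow>
     p \<in> c ` {a..b} \<and> collision_point V p \<and> p \<noteq> c a \<and> p \<noteq> c b"

subsection \<open>The action and the Marchal lemma\<close>

text \<open>Absolutely continuous curves are differentiable almost everywhere, so the (unspecified) value
  of \<^const>\<open>vector_derivative\<close> elsewhere does not matter.\<close>

definition Lagrangian :: "('a::euclidean_space \<Rightarrow> ereal) \<Rightarrow> 'a \<Rightarrow> 'a \<Rightarrow> ennreal" where
  "Lagrangian V q v = ennreal ((norm v)\<^sup>2 / 2) + neg_potential V q"

definition action :: "('a::euclidean_space \<Rightarrow> ereal) \<Rightarrow> real \<Rightarrow> (real \<Rightarrow> 'a) \<Rightarrow> ennreal" where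
  "action V T c =
     (\<integral>\<^sup>+t\<in>{0..T}. Lagrangian V (c t) (vector_derivative c (at t)) \<partial>lebesgue)"

definition action_minimizer ::
    "('a::euclidean_space \<Rightarrow> ereal) \<Rightarrow> 'a \<Rightarrow> 'a \<Rightarrow> real \<Rightarrow> (real \<Rightarrow> 'a) \<Rightarrow> bool" where
  "action_minimizer V q0 q1 T c \<longleftrightarrow>
     abs_continuous_curve 0 T c \<and> c 0 = q0 \<and> c T = q1 \<and> action V T c < \<infinity> \<and>
     (\<forall>\<sigma>. abs_continuous_curve 0 T \<sigma> \<and> \<sigma> 0 = q0 \<and> \<sigma> T = q1 \<longrightarrow> action V T c \<le> action V T \<sigma>)"

definition Marchal_lemma :: "('a::euclidean_space \<Rightarrow> ereal) \<Rightarrow> bool" where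
  "Marchal_lemma V \<longleftrightarrow>
     (\<forall>q0 q1 T c. T > 0 \<and> action_minimizer V q0 q1 T c
        \<longrightarrow> \<not> (\<exists>p. interior_collision_point V 0 T c p))"

subsection \<open>The Jacobi-Maupertuis length at energy zero and the JM-Marchal lemma\<close>

definition esqrt :: "ennreal \<Rightarrow> ennreal" where
  "esqrt x = (if x = \<infinity> then \<infinity> else ennreal (sqrt (enn2real x)))"

text \<open>Since \<open>\<infinity> * 0 = 0\<close> in \<^typ>\<open>ennreal\<close>, times at which the curve does not move contribute
  nothing, as it should be for an integral against arc length.\<close>

definition JM_length :: "('a::euclidean_space \<Rightarrow> ereal) \<Rightarrow> real \<Rightarrow> real \<Rightarrow> (real \<Rightarrow> 'a) \<Rightarrow> ennreal" where
  "JM_length V a b c =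
     (\<integral>\<^sup>+t\<in>{a..b}. esqrt (2 * neg_potential V (c t)) * ennreal (norm (vector_derivative c (at t)))
        \<partial>lebesgue)"

definition minimizing_JM_geodesic ::
    "('a::euclidean_space \<Rightarrow> ereal) \<Rightarrow> real \<Rightarrow> real \<Rightarrow> (real \<Rightarrow> 'a) \<Rightarrow> bool" where
  "minimizing_JM_geodesic V a b c \<longleftrightarrow>
     a < b \<and> abs_continuous_curve a b c \<and> JM_length V a b c < \<infinity> \<and>
     (\<forall>a' b' \<sigma>. a' < b' \<and> abs_continuous_curve a' b' \<sigma> \<and> \<sigma> a' = c a \<and> \<sigma> b' = c b
        \<longrightarrow> JM_length V a b c \<le> JM_length V a' b' \<sigma>)"

definition JM_Marchal_lemma :: "('a::euclidean_space \<Rightarrow> ereal) \<Rightarrow> bool" where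
  "JM_Marchal_lemma V \<longleftrightarrow>
     (\<forall>a b c. minimizing_JM_geodesic V a b c \<longrightarrow> \<not> (\<exists>p. interior_collision_point V a b c p))"

subsection \<open>Classes of potentials\<close>

definition homogeneous_of_degree :: "real \<Rightarrow> ('a::real_vector \<Rightarrow> ereal) \<Rightarrow> bool" where
  "homogeneous_of_degree d V \<longleftrightarrow>
     (\<forall>r>0. \<forall>q. q \<noteq> 0 \<longrightarrow> V (r *\<^sub>R q) = ereal (r powr d) * V q)"

definition smooth_away_from_0 :: "('a::real_normed_vector \<Rightarrow> ereal) \<Rightarrow> bool" where
  "smooth_away_from_0 V \<longleftrightarrow>
     (\<forall>q. q \<noteq> 0 \<longrightarrow> \<bar>V q\<bar> \<noteq> \<infinity>) \<and> smooth_on (- {0}) (\<lambda>q. real_of_ereal (V q))"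

end

(* Let S(q) = (q . e) / sqrt |q| for a unit vector e, which is smooth away from 0 and continuous at 0, and
   let U = |grad S|^2 / 2, a homogeneous function of degree -1 with U >= 1 / (8 |q|). Then V = -U is the
   potential. S is a calibration: along every curve the JM length is at least the increase of S, and
   by sqrt (2 U) |v| <= |v|^2 / 2 + U the action is at least the JM length. On the line spanned by e the
   gradient of S is parallel to e, so the zero-energy motion from -e through the collision at 0 to e has
   action equal to the increase of S and is a minimizer in both senses.

   The bound on the JM length needs the fundamental theorem of calculus for absolutely continuous
   curves. Differentiability almost everywhere is obtained directly, without bounded variation: if
   secant slopes below p and above q > p both occur at arbitrarily small scales on E, two Vitali
   coverings of E by such intervals differ by a set of small measure, on which the function hardly
   varies, so E is null. *)
theory Submission
  imports Defs
begin

subsection \<open>Increments over divisions\<close>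

text \<open>The equation U = |grad S|^2 / 2 is the Hamilton-Jacobi equation at energy 0. Here it is
  read backwards: S is prescribed and the potential is computed from it. Two features of S matter.
  Its positive degree 1/2 makes it continuous at the collision and gives U the degree -1. And it
  changes sign along the line of e, S (- e) = -1 and S e = 1, so a motion straight through the
  origin keeps gaining. A radial solution such as a multiple of sqrt |q| has its minimum at the
  origin: its gradient lines only emanate from there, and it gives no calibration across the
  collision. Both functionals are compared with the single number S e - S (- e) = 2.

  The obstacle lies with the competitors. They are arbitrary absolutely continuous curves, which may
  meet the origin on any closed set of times, and there the gradient of S is unbounded, so S along
  such a curve is not evidently absolutely continuous. Hence the calibration is first proved for
  bounded modifications of its gradient near the origin, and the modification is removed at the
  end.\<close>

abbreviation increment :: "(real \<Rightarrow> 'a::real_normed_vector) \<Rightarrow> real set \<Rightarrow> 'a" where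
  "increment f I \<equiv> f (Sup I) - f (Inf I)"

lemma division_memberD:
  fixes D :: "real set set"
  assumes "D division_of S" "I \<in> D"
  shows "\<exists>u v. I = {u..v} \<and> u \<le> v"
proof -
  obtain u v where "I = {u..v}" using division_ofD(4)[OF assms] by (metis box_real(2))
  moreover have "I \<noteq> {}" using division_ofD(3)[OF assms] .
  ultimately show ?thesis by auto
qed

lemma sum_increment_division:
  fixes f :: "real \<Rightarrow> 'a::real_normed_vector"
  assumes "a \<le> b" "D division_of {a..b}"
  shows "(\<Sum>I\<in>D. increment f I) = f b - f a"
proof -
  \<comment> \<open>Any tag would do: telescoping is available for tagged divisions, and its sum
    depends on the intervals only.\<close>
  have "(\<lambda>I. (Inf I, I)) ` D tagged_division_of {a..b}"
  proof (rule tagged_division_ofI)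
    show "finite ((\<lambda>I. (Inf I, I)) ` D)"
      using assms(2) by auto
    fix x k assume "(x, k) \<in> (\<lambda>I. (Inf I, I)) ` D"
    then have k: "k \<in> D" "x = Inf k" by auto
    then obtain u v where uv: "k = cbox u v" "k \<noteq> {}"
      using division_ofD[OF assms(2)] by metis
    then show "\<exists>a b. k = cbox a b" "x \<in> k" using k by auto
    show "k \<subseteq> {a..b}" using division_ofD(2)[OF assms(2) k(1)] .
  next
    fix x1 k1 x2 k2
    assume "(x1, k1) \<in> (\<lambda>I. (Inf I, I)) ` D" "(x2, k2) \<in> (\<lambda>I. (Inf I, I)) ` D" "(x1, k1) \<noteq> (x2, k2)"
    then show "interior k1 \<inter> interior k2 = {}"
      using division_ofD(5)[OF assms(2)] by auto
  next
    have "{k. \<exists>x. (x, k) \<in> (\<lambda>I. (Inf I, I)) ` D} = D" by auto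
    then show "\<Union>{k. \<exists>x. (x, k) \<in> (\<lambda>I. (Inf I, I)) ` D} = {a..b}"
      using division_ofD(6)[OF assms(2)] by simp
  qed
  from additive_tagged_division_1[OF assms(1) this, of f]
  show ?thesis
    by (subst (asm) sum.reindex) (auto intro: inj_onI)
qed

lemma sum_increment_mono_le:
  fixes f :: "real \<Rightarrow> real"
  assumes "a \<le> b" and D: "D division_of \<Union>D" "\<Union>D \<subseteq> {a..b}" and "mono_on {a..b} f"
  shows "(\<Sum>I\<in>D. increment f I) \<le> f b - f a"
proof -
  obtain Q where Q: "D \<subseteq> Q" "Q division_of {a..b}"
    using partial_division_extend_interval[OF D(1), of a b] D(2) by auto
  have "increment f I \<ge> 0" if I: "I \<in> Q" for I
  proof -
    obtain u v where "I = cbox u v" "I \<noteq> {}" "I \<subseteq> {a..b}"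
      using division_ofD[OF Q(2)] I by metis
    then show ?thesis using assms(4) by (auto simp: mono_on_def)
  qed
  then have "(\<Sum>I\<in>D. increment f I) \<le> (\<Sum>I\<in>Q. increment f I)"
    using Q by (intro sum_mono2) auto
  then show ?thesis using sum_increment_division[OF assms(1) Q(2), of f] by simp
qed

lemma sum_length_eq_measure:
  fixes D :: "real set set"
  assumes "D division_of S"
  shows "(\<Sum>I\<in>D. Sup I - Inf I) = measure lebesgue S"
proof -
  have "((\<lambda>x. 1::real) has_integral (Sup I - Inf I)) I" if I: "I \<in> D" for I
  proof -
    obtain u v where "I = {u..v}" "I \<noteq> {}" using division_ofD[OF assms] I by (metis box_real(2))
    then show ?thesis using has_integral_const_real[of "1::real" u v] by auto
  qed
  from has_integral_combine_division[OF assms this]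
  have *: "((\<lambda>x. 1::real) has_integral (\<Sum>I\<in>D. Sup I - Inf I)) S" by simp
  then have "S \<in> lmeasurable" by (auto simp: lmeasurable_iff_integrable_on)
  then show ?thesis using * by (simp add: lmeasure_integral integral_unique)
qed

text \<open>Extending \<open>D\<close> to a division of \<open>{a..b}\<close> and then \<open>D'\<close> together with the added intervals to
  another one avoids having to refine \<open>D\<close>.\<close>

lemma division_remainder:
  fixes D D' :: "real set set"
  assumes "a \<le> b" and D: "D division_of \<Union>D" "\<Union>D \<subseteq> {a..b}"
    and D': "D' division_of \<Union>D'" "\<Union>D' \<subseteq> \<Union>D" and int: "\<And>I. I \<in> D' \<Longrightarrow> interior I \<noteq> {}"
  shows "\<exists>R. R division_of \<Union>R \<and> \<Union>R \<subseteq> {a..b} \<and>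
    (\<forall>f::real\<Rightarrow>real. (\<Sum>I\<in>D. increment f I) = (\<Sum>I\<in>D'. increment f I) + (\<Sum>I\<in>R. increment f I))"
proof -
  obtain Q where Q: "D \<subseteq> Q" "Q division_of {a..b}"
    using partial_division_extend_interval[OF D(1), of a b] D(2) by auto
  note q = division_ofD[OF Q(2)]
  note d = division_ofD[OF D(1)]
  note d' = division_ofD[OF D'(1)]
  define X where "X = Q - D"
  have XQ: "X \<subseteq> Q" by (auto simp: X_def)
  have disj: "interior I \<inter> interior K = {}" if IK: "I \<in> D'" "K \<in> X" for I K
  proof -
    obtain u v where K: "K = cbox u v" using q(4) IK(2) XQ by blast
    have "interior (\<Union>D) \<inter> interior K = {}"
    proof -
      have "interior K \<inter> interior T = {}" if "T \<in> D" for T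
        using q(5)[of K T] IK(2) Q(1) that by (auto simp: X_def)
      then show ?thesis
        using Int_interior_Union_intervals[of D "interior K"] d(1,4) by blast
    qed
    moreover have "interior I \<subseteq> interior (\<Union>D)"
      using IK D'(2) by (intro interior_mono) auto
    ultimately show ?thesis by auto
  qed
  have div: "D' \<union> X division_of \<Union>(D' \<union> X)"
  proof (rule division_ofI)
    show "K \<subseteq> \<Union>(D' \<union> X)" if "K \<in> D' \<union> X" for K using that by blast
    show "K \<noteq> {}" if "K \<in> D' \<union> X" for K using that d'(3) q(3) XQ by blast
    show "\<exists>a b. K = cbox a b" if "K \<in> D' \<union> X" for K using that d'(4)[of K] q(4)[of K] XQ by blast
    show "finite (D' \<union> X)" using q(1) d'(1) XQ finite_subset by blast
    show "interior K \<inter> interior K' = {}" if "K \<in> D' \<union> X" "K' \<in> D' \<union> X" "K \<noteq> K'" for K K'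
      using that d'(5)[of K K'] q(5)[of K K'] XQ disj[of K K'] disj[of K' K]
      by (auto simp: Int_commute)
  qed simp
  have "\<Union>(D' \<union> X) \<subseteq> {a..b}" using D D' q(2) XQ by blast
  then obtain Q' where Q': "D' \<union> X \<subseteq> Q'" "Q' division_of {a..b}"
    by (rule partial_division_extend_interval[OF div, of a b, unfolded box_real])
  define R where "R = Q' - (D' \<union> X)"
  have RQ: "R \<subseteq> Q'" by (auto simp: R_def)
  show ?thesis
  proof (intro exI[of _ R] conjI allI)
    show "R division_of \<Union>R" using division_of_subset[of Q' R] RQ division_ofD(6)[OF Q'(2)] Q'(2) by simp
    show "\<Union>R \<subseteq> {a..b}" using RQ division_ofD(2)[OF Q'(2)] by blast
    fix f :: "real \<Rightarrow> real"
    have fin: "finite D" "finite X" "finite D'" "finite R"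
      using d(1) q(1) d'(1) XQ RQ division_ofD(1)[OF Q'(2)] finite_subset by blast+
    \<comment> \<open>Disjoint interiors alone would allow a one-point interval to belong to both
      families and be counted once instead of twice. Nonempty interiors in \<open>D'\<close> exclude
      this.\<close>
    have "D' \<inter> X = {}" using disj int by blast
    have "f b - f a = (\<Sum>I\<in>D \<union> X. increment f I)"
      using sum_increment_division[OF assms(1) Q(2), of f] Q(1) by (auto simp: X_def Un_absorb1)
    also have "\<dots> = (\<Sum>I\<in>D. increment f I) + (\<Sum>I\<in>X. increment f I)"
      using fin by (intro sum.union_disjoint) (auto simp: X_def)
    finally have 1: "f b - f a = (\<Sum>I\<in>D. increment f I) + (\<Sum>I\<in>X. increment f I)" .
    have "f b - f a = (\<Sum>I\<in>(D' \<union> X) \<union> R. increment f I)"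
      using sum_increment_division[OF assms(1) Q'(2), of f] Q'(1) by (auto simp: R_def Un_absorb1)
    also have "\<dots> = (\<Sum>I\<in>D' \<union> X. increment f I) + (\<Sum>I\<in>R. increment f I)"
      using fin by (intro sum.union_disjoint) (auto simp: R_def)
    also have "(\<Sum>I\<in>D' \<union> X. increment f I) = (\<Sum>I\<in>D'. increment f I) + (\<Sum>I\<in>X. increment f I)"
      using fin \<open>D' \<inter> X = {}\<close> by (intro sum.union_disjoint) auto
    finally show "(\<Sum>I\<in>D. increment f I) = (\<Sum>I\<in>D'. increment f I) + (\<Sum>I\<in>R. increment f I)"
      using 1 by simp
  qed
qed

section \<open>Vitali coverings by finitely many intervals\<close>

text \<open>Vitali's theorem gives a countable disjoint family that covers \<open>E\<close> up to a
  null set. Its union has finite measure because it lies in \<open>O'\<close>, so a finite subfamily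
  loses less than \<eta>. The set \<open>E\<close> need not be measurable, hence the uncovered part
  is enclosed in a measurable \<open>W\<close> instead of being measured itself.\<close>

lemma Vitali_finite_intervals:
  fixes E O' :: "real set"
  assumes O': "open O'" "O' \<in> lmeasurable" "E \<subseteq> O'" and "\<eta> > 0"
    and P: "\<And>x d. x \<in> E \<Longrightarrow> d > 0 \<Longrightarrow> \<exists>s t. s < t \<and> x \<in> {s..t} \<and> t - s < d \<and> P s t"
  shows "\<exists>D W. D division_of \<Union>D \<and> \<Union>D \<subseteq> O' \<and> (\<forall>I\<in>D. \<exists>s t. s < t \<and> I = {s..t} \<and> P s t) \<and>
    W \<in> lmeasurable \<and> E - \<Union>D \<subseteq> W \<and> measure lebesgue W < \<eta>"
proof -
  define K where "K = {(s,t). s < t \<and> {s..t} \<subseteq> O' \<and> P s t}"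
  define c where "c = (\<lambda>(s,t::real). (s + t) / 2)"
  define r where "r = (\<lambda>(s,t::real). (t - s) / 2)"
  have cb: "cball (c i) (r i) = {fst i..snd i}" for i
    by (auto simp: c_def r_def cball_eq_atLeastAtMost field_simps split: prod.splits)
  have "\<exists>i. i \<in> K \<and> x \<in> cball (c i) (r i) \<and> r i < d" if x: "x \<in> E" and d: "d > 0" for x d
  proof -
    obtain e where e: "e > 0" "ball x e \<subseteq> O'"
      using x O' openE by blast
    obtain s t where st: "s < t" "x \<in> {s..t}" "t - s < min d e" "P s t"
      using P[OF x, of "min d e"] d e(1) by auto
    have "{s..t} \<subseteq> ball x e"
      using st by (auto simp: dist_real_def)
    then have "(s,t) \<in> K" using st e by (auto simp: K_def)
    moreover have "r (s,t) < d" using st d by (auto simp: r_def)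
    ultimately show ?thesis using cb st(2) by fastforce
  qed
  note small = this
  have "0 < r i" if "i \<in> K" for i
    using that by (auto simp: K_def r_def)
  then obtain C where C: "countable C" "C \<subseteq> K"
     "pairwise (\<lambda>i j. disjnt (cball (c i) (r i)) (cball (c j) (r j))) C"
     "negligible(E - (\<Union>i \<in> C. cball (c i) (r i)))"
    by (rule Vitali_covering_theorem_cballs[of K r E c, OF _ small])
  define F where "F = (\<lambda>i. {fst i..snd i}) ` C"
  have FI: "\<exists>s t. s < t \<and> I = {s..t} \<and> {s..t} \<subseteq> O' \<and> P s t" if "I \<in> F" for I
    using that C(2) by (force simp: F_def K_def)
  have Fdis: "I \<inter> J = {}" if IJ: "I \<in> F" "J \<in> F" "I \<noteq> J" for I J
  proof -
    obtain i j where ij: "i \<in> C" "I = {fst i..snd i}" "j \<in> C" "J = {fst j..snd j}"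
      using IJ(1,2) unfolding F_def by blast
    then have "i \<noteq> j" using IJ(3) by blast
    from pairwiseD[OF C(3) ij(1,3) this] ij show ?thesis
      unfolding cb by (simp add: disjnt_def)
  qed
  have Fc: "countable F" using C(1) by (auto simp: F_def)
  have Fm: "I \<in> lmeasurable" if "I \<in> F" for I
    using FI[OF that] by (metis lmeasurable_cbox box_real(2))
  have FO: "\<Union>F \<subseteq> O'" using FI by blast
  have FOm: "\<Union>F \<in> lmeasurable"
    using Fc Fm FO O' by (intro fmeasurableI2[OF O'(2)] sets.countable_Union) auto
  have neg: "negligible (E - \<Union>F)" using C(4) by (simp add: F_def cb)
  have "measure lebesgue (\<Union>D') \<le> measure lebesgue O'" if "D' \<subseteq> F" "finite D'" for D'
    using that FO Fm O' by (intro measure_mono_fmeasurable sets.finite_Union) auto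
  then obtain D where D: "D \<subseteq> F" "finite D" "measure lebesgue (\<Union>F) - \<eta> < measure lebesgue (\<Union>D)"
    using measure_countable_Union_approachable[OF Fc \<open>\<eta> > 0\<close> Fm] by metis
  have Dm: "\<Union>D \<in> lmeasurable" using D Fm by (intro fmeasurable.finite_Union) auto
  \<comment> \<open>The null set missed by the countable family, together with the tail discarded in
    passing to a finite one.\<close>
  define W where "W = (E - \<Union>F) \<union> (\<Union>F - \<Union>D)"
  show ?thesis
  proof (intro exI[of _ D] exI[of _ W] conjI ballI)
    show "D division_of \<Union>D"
    proof (rule division_ofI[OF D(2)])
      fix I assume "I \<in> D"
      moreover obtain s t where "s < t" "I = {s..t}"
        using FI[of I] D(1) \<open>I \<in> D\<close> by blast
      ultimately show "I \<subseteq> \<Union>D" "I \<noteq> {}" "\<exists>a b. I = cbox a b"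
        by (blast, simp, metis box_real(2))
    next
      fix I J assume "I \<in> D" "J \<in> D" "I \<noteq> J"
      then show "interior I \<inter> interior J = {}"
        using D(1) Fdis interior_subset by blast
    qed simp
    show "\<Union>D \<subseteq> O'" using D FO by blast
    show "\<exists>s t. s < t \<and> I = {s..t} \<and> P s t" if "I \<in> D" for I
      using that D(1) FI by blast
    have n: "E - \<Union>F \<in> null_sets lebesgue" using neg by (simp add: negligible_iff_null_sets)
    show "W \<in> lmeasurable"
      unfolding W_def using negligible_imp_measurable[OF neg] FOm Dm
      by (intro fmeasurable.Un) (auto intro: fmeasurable.Diff)
    show "E - \<Union>D \<subseteq> W" by (auto simp: W_def)
    have "measure lebesgue W = measure lebesgue (\<Union>F - \<Union>D)"
      unfolding W_def by (subst Un_commute, rule measure_Un_null_set[OF _ n]) (use FOm Dm in auto)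
    also have "\<dots> = measure lebesgue (\<Union>F) - measure lebesgue (\<Union>D)"
      using FOm Dm D(1) by (intro measurable_measure_Diff) auto
    finally show "measure lebesgue W < \<eta>" using D(3) by simp
  qed
qed

subsection \<open>Absolutely continuous functions\<close>

lemma abs_continuous_curveD:
  fixes f :: "real \<Rightarrow> 'a::real_normed_vector"
  assumes "abs_continuous_curve a b f" "\<epsilon> > 0"
  shows "\<exists>\<delta>>0. \<forall>D. D division_of \<Union>D \<longrightarrow> \<Union>D \<subseteq> {a..b} \<longrightarrow> measure lebesgue (\<Union>D) < \<delta> \<longrightarrow>
       (\<Sum>I\<in>D. norm (increment f I)) < \<epsilon>"
proof -
  obtain \<delta> where "\<delta> > 0" and \<delta>: "\<And>D. D division_of \<Union>D \<and> \<Union>D \<subseteq> {a..b} \<and> (\<Sum>I\<in>D. Sup I - Inf I) < \<delta>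
        \<longrightarrow> (\<Sum>I\<in>D. norm (increment f I)) < \<epsilon>"
    using assms unfolding abs_continuous_curve_def by blast
  then show ?thesis
    by (intro exI[of _ \<delta>]) (simp add: sum_length_eq_measure)
qed

section \<open>Differentiability almost everywhere\<close>

lemma lmeasurable_outer_open:
  assumes "X \<in> lmeasurable" "e > 0"
  obtains U where "open U" "X \<subseteq> U" "U \<in> lmeasurable" "measure lebesgue U < measure lebesgue X + e"
proof -
  obtain U where U: "open U" "X \<subseteq> U" "U - X \<in> lmeasurable" "emeasure lebesgue (U - X) < ennreal e"
    using sets_lebesgue_outer_open[of X e] assms by (metis fmeasurableD)
  have eq: "U = X \<union> (U - X)" using U by auto
  have m: "measure lebesgue (U - X) < e"
    using U(3,4) assms(2) by (simp add: emeasure_eq_measure2 ennreal_less_iff)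
  have "U \<in> lmeasurable" using fmeasurable.Un[OF assms(1) U(3)] eq by simp
  moreover have "measure lebesgue U \<le> measure lebesgue X + measure lebesgue (U - X)"
    using measure_Un_le[of X lebesgue "U - X"] assms(1) U(3) eq by (metis fmeasurableD)
  ultimately show thesis using that U m by force
qed

text \<open>Let m be the outer measure of \<open>E\<close>. The intervals of \<open>D\<close> have
  slope below p, those of \<open>D'\<close> inside them slope above q, and \<open>R\<close> makes up
  the difference. Then q |D'| - \<epsilon> is at most the increment over \<open>D\<close>, hence at
  most p |D| = p |D'| + p |R|. Since |D'| is nearly m and |R| is small, (q - p) m is bounded by a
  constant times \<epsilon>.\<close>

lemma negligible_if_Dini_gap:
  fixes f :: "real \<Rightarrow> real"
  assumes ac: "abs_continuous_curve a b f" and E: "E \<subseteq> {a<..<b}" and "p < q"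
    and lower: "\<And>x d. x \<in> E \<Longrightarrow> d > 0 \<Longrightarrow> \<exists>s t. s < t \<and> x \<in> {s..t} \<and> t - s < d \<and> f t - f s < p * (t - s)"
    and upper: "\<And>x d. x \<in> E \<Longrightarrow> d > 0 \<Longrightarrow> \<exists>s t. s < t \<and> x \<in> {s..t} \<and> t - s < d \<and> f t - f s > q * (t - s)"
  shows "negligible E"
proof (cases "E = {}")
  case False
  then have ab: "a \<le> b" using E by fastforce
  \<comment> \<open>Measurability of \<open>E\<close> is not known, so its outer measure
    \<open>m\<close> is used.\<close>
  define M where "M = {measure lebesgue X |X. X \<in> lmeasurable \<and> E \<subseteq> X}"
  define m where "m = Inf M"
  have Mb: "bdd_below M" by (rule bdd_belowI[of _ 0]) (auto simp: M_def)
  have "measure lebesgue {a<..<b} \<in> M"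
    unfolding M_def using E by (auto intro!: exI[of _ "{a<..<b}"])
  then have Mne: "M \<noteq> {}" by auto
  have m_le: "m \<le> measure lebesgue X" if "X \<in> lmeasurable" "E \<subseteq> X" for X
    unfolding m_def using that by (intro cInf_lower[OF _ Mb]) (auto simp: M_def)
  have m_ge: "m \<ge> 0" unfolding m_def by (rule cInf_greatest[OF Mne]) (auto simp: M_def)
  have main: "(q - p) * m \<le> \<epsilon> * (1 + \<bar>p\<bar> * 3 + (q - p) * 2)" if "\<epsilon> > 0" for \<epsilon>
  proof -
    obtain \<delta> where \<delta>: "\<delta> > 0" "\<And>D. D division_of \<Union>D \<Longrightarrow> \<Union>D \<subseteq> {a..b} \<Longrightarrow> measure lebesgue (\<Union>D) < \<delta> \<Longrightarrow>
       (\<Sum>I\<in>D. norm (increment f I)) < \<epsilon>"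
      using abs_continuous_curveD[OF ac \<open>\<epsilon> > 0\<close>] by blast
    \<comment> \<open>\<open>R\<close> will have measure at most 3 \<eta>: one \<eta> from the open
      set around \<open>E\<close> and one from each of the two incomplete coverings. This has to
      stay below \<delta>.\<close>
    define \<eta> where "\<eta> = min \<epsilon> (\<delta> / 4)"
    have \<eta>: "\<eta> > 0" "\<eta> \<le> \<epsilon>" "3 * \<eta> < \<delta>" using \<delta>(1) that by (auto simp: \<eta>_def)
    have "Inf M < m + \<eta> / 2" using \<eta> by (simp add: m_def)
    then obtain X where X: "X \<in> lmeasurable" "E \<subseteq> X" "measure lebesgue X < m + \<eta> / 2"
      using cInf_lessD[OF Mne] unfolding M_def by blast
    obtain U where U: "open U" "X \<subseteq> U" "U \<in> lmeasurable" "measure lebesgue U < measure lebesgue X + \<eta> / 2"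
      using lmeasurable_outer_open[OF X(1), of "\<eta> / 2"] \<eta> by auto
    define V where "V = U \<inter> {a<..<b}"
    have V: "open V" "V \<in> lmeasurable" "E \<subseteq> V" 
      using U X E by (auto simp: V_def intro: fmeasurable_Int_fmeasurable)
    have "measure lebesgue V \<le> measure lebesgue U"
      using U V by (intro measure_mono_fmeasurable) (auto simp: V_def)
    then have Vm: "measure lebesgue V < m + \<eta>" using U X by simp
    have "\<exists>D W. D division_of \<Union>D \<and> \<Union>D \<subseteq> V \<and> (\<forall>I\<in>D. \<exists>s t. s < t \<and> I = {s..t} \<and> f t - f s < p * (t - s)) \<and>
        W \<in> lmeasurable \<and> E - \<Union>D \<subseteq> W \<and> measure lebesgue W < \<eta>"
      by (rule Vitali_finite_intervals[OF V \<eta>(1)]) (rule lower)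
    then obtain D W where D: "D division_of \<Union>D" "\<Union>D \<subseteq> V"
      "\<forall>I\<in>D. \<exists>s t. s < t \<and> I = {s..t} \<and> f t - f s < p * (t - s)"
      and W: "W \<in> lmeasurable" "E - \<Union>D \<subseteq> W" "measure lebesgue W < \<eta>"
      by blast
    have Dm: "\<Union>D \<in> lmeasurable"
      using D(1) by (meson lmeasurable_division)
    \<comment> \<open>The second covering needs an open set. Passing to the interior loses only the
      endpoints of finitely many intervals, collected below in the null set
      \<open>F\<close>.\<close>
    define V' where "V' = interior (\<Union>D)"
    have V': "open V'" "V' \<in> lmeasurable" "V' \<subseteq> \<Union>D"
      using fmeasurableI2[OF Dm, of V'] interior_subset[of "\<Union>D"] by (auto simp: V'_def)
    have "\<exists>D W. D division_of \<Union>D \<and> \<Union>D \<subseteq> V' \<and> (\<forall>I\<in>D. \<exists>s t. s < t \<and> I = {s..t} \<and> f t - f s > q * (t - s)) \<and>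
        W \<in> lmeasurable \<and> E \<inter> V' - \<Union>D \<subseteq> W \<and> measure lebesgue W < \<eta>"
      by (rule Vitali_finite_intervals[OF V'(1,2) _ \<eta>(1)]) (auto intro: upper simp del: atLeastAtMost_iff)
    then obtain D' W' where D': "D' division_of \<Union>D'" "\<Union>D' \<subseteq> V'"
      "\<forall>I\<in>D'. \<exists>s t. s < t \<and> I = {s..t} \<and> f t - f s > q * (t - s)"
      and W': "W' \<in> lmeasurable" "E \<inter> V' - \<Union>D' \<subseteq> W'" "measure lebesgue W' < \<eta>"
      by blast
    have D'm: "\<Union>D' \<in> lmeasurable"
      using D'(1) by (meson lmeasurable_division)
    have sub: "\<Union>D \<subseteq> {a..b}" "\<Union>D' \<subseteq> \<Union>D" using D(2) D'(2) V'(3) by (auto simp: V_def)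
    have "interior I \<noteq> {}" if "I \<in> D'" for I
      using D'(3) that by fastforce
    then obtain R where R: "R division_of \<Union>R" "\<Union>R \<subseteq> {a..b}"
      and Rsum: "\<forall>f::real\<Rightarrow>real. (\<Sum>I\<in>D. increment f I) = (\<Sum>I\<in>D'. increment f I) + (\<Sum>I\<in>R. increment f I)"
      using division_remainder[OF ab D(1) sub(1) D'(1) sub(2)] by blast
    \<comment> \<open>The remainder identity for the identity function splits lengths; later, for
      \<open>f\<close>, it splits increments.\<close>
    have len: "measure lebesgue (\<Union>D) = measure lebesgue (\<Union>D') + measure lebesgue (\<Union>R)"
      using Rsum[rule_format, of "\<lambda>x. x"] D(1) D'(1) R(1) by (simp add: sum_length_eq_measure)
    define F where "F = frontier (\<Union>D)"
    have "finite D" using D(1) by auto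
    have "negligible (frontier I)" if I: "I \<in> D" for I
    proof -
      obtain s t where "I = {s..t}" using D(3) I by blast
      then show ?thesis using negligible_convex_frontier[of "{s..t}"] by simp
    qed
    then have "negligible (\<Union>I\<in>D. frontier I)"
      using \<open>finite D\<close> by (intro negligible_Union) auto
    moreover have "F \<subseteq> (\<Union>I\<in>D. frontier I)"
      unfolding F_def using frontier_Union_subset[OF \<open>finite D\<close>] by auto
    ultimately have Fneg: "negligible F" by (rule negligible_subset)
    have cov: "E \<subseteq> (\<Union>D' \<union> W) \<union> W' \<union> F"
      using W(2) W'(2) closure_subset[of "\<Union>D"] by (auto simp: F_def frontier_def V'_def)
    have "m \<le> measure lebesgue ((\<Union>D' \<union> W) \<union> W' \<union> F)"
      using W W' D'm Fneg negligible_imp_measurable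
      by (intro m_le cov fmeasurable.Un) auto
    also have "\<dots> = measure lebesgue ((\<Union>D' \<union> W) \<union> W')"
      using W W' D'm Fneg
      by (intro measure_Un_null_set) (auto simp: negligible_iff_null_sets)
    also have "\<dots> \<le> measure lebesgue (\<Union>D') + measure lebesgue W + measure lebesgue W'"
      using measure_Un_le[of "\<Union>D' \<union> W" lebesgue W'] measure_Un_le[of "\<Union>D'" lebesgue W] W W' D'm
      by (auto dest!: fmeasurableD)
    finally have m_le_D': "m - 2 * \<eta> \<le> measure lebesgue (\<Union>D')" using W W' by simp
    have "measure lebesgue (\<Union>D) \<le> measure lebesgue V"
      using D(2) V Dm by (intro measure_mono_fmeasurable) auto
    then have Rm: "measure lebesgue (\<Union>R) \<le> 3 * \<eta>" using Vm m_le_D' len by simp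
    then have "(\<Sum>I\<in>R. norm (increment f I)) < \<epsilon>" using \<delta>(2)[OF R] \<eta> by simp
    moreover have "\<bar>\<Sum>I\<in>R. increment f I\<bar> \<le> (\<Sum>I\<in>R. norm (increment f I))"
      using norm_sum[of "increment f" R] by simp
    ultimately have Rf: "(\<Sum>I\<in>R. increment f I) \<ge> - \<epsilon>" by linarith
    have "(\<Sum>I\<in>D'. q * (Sup I - Inf I)) \<le> (\<Sum>I\<in>D'. increment f I)"
      using D'(3) by (intro sum_mono) force
    then have "q * measure lebesgue (\<Union>D') \<le> (\<Sum>I\<in>D'. increment f I)"
      by (simp add: sum_distrib_left[symmetric] sum_length_eq_measure[OF D'(1)])
    moreover have "(\<Sum>I\<in>D. increment f I) \<le> (\<Sum>I\<in>D. p * (Sup I - Inf I))"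
      using D(3) by (intro sum_mono) force
    then have "(\<Sum>I\<in>D. increment f I) \<le> p * measure lebesgue (\<Union>D)"
      by (simp add: sum_distrib_left[symmetric] sum_length_eq_measure[OF D(1)])
    ultimately have "(q - p) * measure lebesgue (\<Union>D') \<le> \<epsilon> + p * measure lebesgue (\<Union>R)"
      using Rf Rsum[rule_format, of f] by (simp add: len algebra_simps)
    also have "p * measure lebesgue (\<Union>R) \<le> \<bar>p\<bar> * (3 * \<epsilon>)"
      using Rm \<eta> by (intro mult_mono) auto
    finally have "(q - p) * measure lebesgue (\<Union>D') \<le> \<epsilon> + \<bar>p\<bar> * (3 * \<epsilon>)" by simp
    moreover have "(q - p) * (m - 2 * \<epsilon>) \<le> (q - p) * measure lebesgue (\<Union>D')"
      using m_le_D' \<eta> \<open>p < q\<close> by (intro mult_left_mono) auto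
    ultimately show ?thesis by (simp add: algebra_simps)
  qed
  have "m = 0"
  proof (rule ccontr)
    assume "m \<noteq> 0"
    then have pos: "(q - p) * m > 0" using m_ge \<open>p < q\<close> by simp
    define k where "k = 1 + \<bar>p\<bar> * 3 + (q - p) * 2"
    have "k > 0" using \<open>p < q\<close> by (simp add: k_def add_pos_nonneg)
    have "(q - p) * m \<le> ((q - p) * m / (2 * k)) * k"
      using main[of "(q - p) * m / (2 * k)"] pos \<open>k > 0\<close> unfolding k_def[symmetric] by simp
    then show False using pos \<open>k > 0\<close> by (simp add: mult.commute)
  qed
  show ?thesis
    unfolding negligible_outer
  proof safe
    fix e :: real assume "e > 0"
    then have "Inf M < e" using \<open>m = 0\<close> by (simp add: m_def)
    then show "\<exists>T. E \<subseteq> T \<and> T \<in> lmeasurable \<and> measure lebesgue T < e"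
      using cInf_lessD[OF Mne] unfolding M_def by blast
  qed
qed simp

text \<open>On a piece shorter than \<delta> the sum of the absolute increments over a division is
  below 1. Intervals on which the slope exceeds n in absolute value therefore have total length
  below 1 / n, and n is arbitrary. The argument is local because \<delta> limits the total
  length.\<close>

lemma negligible_if_Dini_infinite:
  fixes f :: "real \<Rightarrow> real"
  assumes ac: "abs_continuous_curve a b f" and E: "E \<subseteq> {a<..<b}"
    and large: "\<And>x n d. x \<in> E \<Longrightarrow> d > 0 \<Longrightarrow>
      \<exists>s t. s < t \<and> x \<in> {s..t} \<and> t - s < d \<and> \<bar>f t - f s\<bar> > real n * (t - s)"
  shows "negligible E"
proof -
  obtain \<delta> where \<delta>: "\<delta> > 0" "\<And>D. D division_of \<Union>D \<Longrightarrow> \<Union>D \<subseteq> {a..b} \<Longrightarrow> measure lebesgue (\<Union>D) < \<delta> \<Longrightarrow>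
     (\<Sum>I\<in>D. norm (increment f I)) < 1"
    using abs_continuous_curveD[OF ac zero_less_one] by blast
  show ?thesis
  proof (subst locally_negligible_alt, rule ballI)
    fix x assume "x \<in> E"
    define V where "V = {a<..<b} \<inter> ball x (\<delta> / 4)"
    have V: "open V" "V \<in> lmeasurable" "E \<inter> V \<subseteq> V"
      by (auto simp: V_def intro: fmeasurable.Int)
    have "negligible (E \<inter> V)"
      unfolding negligible_outer
    proof safe
      fix e :: real assume e: "e > 0"
      obtain n where n: "real n > 2 / e" using reals_Archimedean2 by blast
      then have n0: "real n > 0" using e by (meson divide_pos_pos less_trans zero_less_numeral)
      have "\<exists>D W. D division_of \<Union>D \<and> \<Union>D \<subseteq> V \<and> (\<forall>I\<in>D. \<exists>s t. s < t \<and> I = {s..t} \<and> \<bar>f t - f s\<bar> > real n * (t - s)) \<and>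
        W \<in> lmeasurable \<and> E \<inter> V - \<Union>D \<subseteq> W \<and> measure lebesgue W < e / 2"
      by (rule Vitali_finite_intervals[OF V]) (use e in \<open>auto intro: large simp del: atLeastAtMost_iff\<close>)
    then obtain D W where D: "D division_of \<Union>D" "\<Union>D \<subseteq> V"
      "\<forall>I\<in>D. \<exists>s t. s < t \<and> I = {s..t} \<and> \<bar>f t - f s\<bar> > real n * (t - s)"
      and W: "W \<in> lmeasurable" "E \<inter> V - \<Union>D \<subseteq> W" "measure lebesgue W < e / 2"
      by blast
      have Dm: "\<Union>D \<in> lmeasurable"
        using D(1) by (meson lmeasurable_division)
      have "measure lebesgue (\<Union>D) \<le> measure lebesgue (ball x (\<delta> / 4))"
        using D(2) Dm by (intro measure_mono_fmeasurable) (auto simp: V_def)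
      also have "\<dots> < \<delta>" using \<delta>(1) by (simp add: ball_eq_greaterThanLessThan)
      finally have "(\<Sum>I\<in>D. norm (increment f I)) < 1"
        using D(2) by (intro \<delta>(2)[OF D(1)]) (auto simp: V_def)
      moreover have "(\<Sum>I\<in>D. real n * (Sup I - Inf I)) \<le> (\<Sum>I\<in>D. norm (increment f I))"
        using D(3) by (intro sum_mono) force
      ultimately have "real n * measure lebesgue (\<Union>D) < 1"
        by (simp add: sum_distrib_left[symmetric] sum_length_eq_measure[OF D(1)])
      then have "measure lebesgue (\<Union>D) < 1 / real n"
        using n0 by (simp add: field_simps)
      also have "\<dots> < e / 2" using n n0 e by (simp add: field_simps)
      finally have "measure lebesgue (\<Union>D \<union> W) < e"
        using measure_Un_le[of "\<Union>D" lebesgue W] W Dm by (auto dest!: fmeasurableD)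
      moreover have "E \<inter> V \<subseteq> \<Union>D \<union> W" using W by auto
      moreover have "\<Union>D \<union> W \<in> lmeasurable" using W Dm by auto
      ultimately show "\<exists>T. E \<inter> V \<subseteq> T \<and> T \<in> lmeasurable \<and> measure lebesgue T < e" by blast
    qed
    moreover have "openin (top_of_set E) (E \<inter> V)" using V by auto
    moreover have "x \<in> E \<inter> V" using \<open>x \<in> E\<close> E \<delta> by (auto simp: V_def)
    ultimately show "\<exists>U. openin (top_of_set E) U \<and> x \<in> U \<and> negligible U" by blast
  qed
qed

text \<open>Serves both for the coordinates of a curve, with K = 1, and for the composition of a
  curve with a function that is Lipschitz on its image.\<close>

lemma abs_continuous_curve_dominated:
  fixes f :: "real \<Rightarrow> 'a::real_normed_vector" and g :: "real \<Rightarrow> 'b::real_normed_vector"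
  assumes f: "abs_continuous_curve a b f"
    and K: "\<And>s t. s \<in> {a..b} \<Longrightarrow> t \<in> {a..b} \<Longrightarrow> norm (g t - g s) \<le> K * norm (f t - f s)"
  shows "abs_continuous_curve a b g"
  unfolding abs_continuous_curve_def
proof (intro allI impI)
  fix \<epsilon> :: real assume "\<epsilon> > 0"
  \<comment> \<open>\<open>K\<close> may be zero or negative, while \<epsilon> is to be divided by
    the constant.\<close>
  define K' where "K' = max K 1"
  have "K' > 0" by (simp add: K'_def)
  then have "\<epsilon> / K' > 0" using \<open>\<epsilon> > 0\<close> by simp
  then obtain \<delta> where \<delta>: "\<delta> > 0" "\<And>D. D division_of \<Union>D \<and> \<Union>D \<subseteq> {a..b} \<and> (\<Sum>I\<in>D. Sup I - Inf I) < \<delta>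
        \<Longrightarrow> (\<Sum>I\<in>D. norm (f (Sup I) - f (Inf I))) < \<epsilon> / K'"
    using f unfolding abs_continuous_curve_def by blast
  have "(\<Sum>I\<in>D. norm (g (Sup I) - g (Inf I))) < \<epsilon>"
    if D: "D division_of \<Union>D \<and> \<Union>D \<subseteq> {a..b} \<and> (\<Sum>I\<in>D. Sup I - Inf I) < \<delta>" for D
  proof -
    have "norm (g (Sup I) - g (Inf I)) \<le> K' * norm (f (Sup I) - f (Inf I))" if ID: "I \<in> D" for I
    proof -
      obtain u v where uv: "I = {u..v}" "u \<le> v"
        using division_memberD[OF conjunct1[OF D] ID] by blast
      moreover have "I \<subseteq> {a..b}" using D ID by blast
      ultimately have "Sup I \<in> {a..b}" "Inf I \<in> {a..b}" by auto
      then have "norm (g (Sup I) - g (Inf I)) \<le> K * norm (f (Sup I) - f (Inf I))" by (intro K)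
      also have "\<dots> \<le> K' * norm (f (Sup I) - f (Inf I))"
        by (intro mult_right_mono) (auto simp: K'_def)
      finally show ?thesis .
    qed
    then have "(\<Sum>I\<in>D. norm (g (Sup I) - g (Inf I))) \<le> K' * (\<Sum>I\<in>D. norm (f (Sup I) - f (Inf I)))"
      unfolding sum_distrib_left by (rule sum_mono)
    also have "\<dots> < \<epsilon>" using \<delta>(2)[OF D] \<open>K' > 0\<close> by (simp add: field_simps)
    finally show ?thesis .
  qed
  then show "\<exists>\<delta>>0. \<forall>D. D division_of \<Union>D \<and> \<Union>D \<subseteq> {a..b} \<and> (\<Sum>I\<in>D. Sup I - Inf I) < \<delta>
        \<longrightarrow> (\<Sum>I\<in>D. norm (g (Sup I) - g (Inf I))) < \<epsilon>"
    using \<delta>(1) by blast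
qed

text \<open>Outside countably many null sets the difference quotients at x are bounded near x, and
  no rational pair p < q separates their lower from their upper limit. So both limits agree and are
  finite. The endpoints are discarded because differentiability is two-sided.\<close>

lemma abs_continuous_differentiable_ae_real:
  fixes f :: "real \<Rightarrow> real"
  assumes ac: "abs_continuous_curve a b f"
  shows "negligible {x \<in> {a..b}. \<not> f differentiable at x}"
proof -
  define \<phi> where "\<phi> x y = (f y - f x) / (y - x)" for x y
  define Einf where "Einf = {x \<in> {a<..<b}. \<forall>n. \<forall>d>0. \<exists>s t. s < t \<and> x \<in> {s..t} \<and> t - s < d \<and>
     \<bar>f t - f s\<bar> > real n * (t - s)}"
  define E where "E p q = {x \<in> {a<..<b}. (\<forall>d>0. \<exists>s t. s < t \<and> x \<in> {s..t} \<and> t - s < d \<and> f t - f s < p * (t - s)) \<and>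
    (\<forall>d>0. \<exists>s t. s < t \<and> x \<in> {s..t} \<and> t - s < d \<and> f t - f s > q * (t - s))}" for p q
  define PQ where "PQ = {(p, q). p \<in> \<rat> \<and> q \<in> \<rat> \<and> p < (q::real)}"
  have "negligible Einf"
    by (rule negligible_if_Dini_infinite[OF ac]) (auto simp: Einf_def)
  moreover have "negligible (E p q)" if "p < q" for p q
    using that by (intro negligible_if_Dini_gap[OF ac, of _ p q]) (auto simp: E_def)
  moreover have "countable PQ"
    by (rule countable_subset[of _ "\<rat> \<times> \<rat>"]) (auto simp: PQ_def countable_rat)
  ultimately have neg: "negligible ({a, b} \<union> Einf \<union> (\<Union>(p, q)\<in>PQ. E p q))"
    by (intro negligible_Un negligible_countable_Union countable_image) (auto simp: PQ_def)
  have "f differentiable at x" if x: "x \<in> {a..b}" "x \<notin> {a, b} \<union> Einf \<union> (\<Union>(p, q)\<in>PQ. E p q)" for x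
  proof -
    have xab: "x \<in> {a<..<b}" using x by auto
    \<comment> \<open>A difference quotient at x is the slope over an interval having x as its left
      or right end. Both sides are treated alike because the covering intervals may contain x
      anywhere.\<close>
    have secant: "\<exists>s t. s < t \<and> x \<in> {s..t} \<and> t - s = \<bar>y - x\<bar> \<and> f t - f s = \<phi> x y * (t - s)" if "y \<noteq> x" for y
      using that by (intro exI[of _ "min x y"] exI[of _ "max x y"]) (auto simp: \<phi>_def min_def max_def field_simps)
    obtain n :: nat and d where nd: "d > 0" "\<And>s t. s < t \<Longrightarrow> x \<in> {s..t} \<Longrightarrow> t - s < d \<Longrightarrow> \<bar>f t - f s\<bar> \<le> real n * (t - s)"
    proof -
      have "x \<notin> Einf" using x(2) by blast
      then have "\<exists>n. \<exists>d>0. \<forall>s t. \<not> (s < t \<and> x \<in> {s..t} \<and> t - s < d \<and> \<bar>f t - f s\<bar> > real n * (t - s))"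
        using xab unfolding Einf_def by blast
      then show thesis using that by (meson not_less)
    qed
    have bnd: "\<bar>\<phi> x y\<bar> \<le> n" if y: "y \<noteq> x" "dist y x < d" for y
    proof -
      obtain s t where st: "s < t" "x \<in> {s..t}" "t - s = \<bar>y - x\<bar>" "f t - f s = \<phi> x y * (t - s)"
        using secant[OF y(1)] by blast
      then have "\<bar>\<phi> x y\<bar> * (t - s) \<le> real n * (t - s)"
        using nd(2)[of s t] y by (simp add: dist_real_def abs_mult)
      then show ?thesis using st(1) by simp
    qed
    then have ev: "\<forall>\<^sub>F y in at x. \<bar>\<phi> x y\<bar> \<le> n"
      using nd(1) unfolding eventually_at by blast
    have gap: "\<not> ((\<exists>\<^sub>F y in at x. \<phi> x y < p) \<and> (\<exists>\<^sub>F y in at x. \<phi> x y > q))" if pq: "(p, q) \<in> PQ" for p q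
    proof safe
      assume p: "\<exists>\<^sub>F y in at x. \<phi> x y < p" and q: "\<exists>\<^sub>F y in at x. \<phi> x y > q"
      have "\<exists>s t. s < t \<and> x \<in> {s..t} \<and> t - s < d \<and> f t - f s < p * (t - s)" if d0: "d > 0" for d
      proof -
        obtain y where y: "y \<noteq> x" "dist y x < d" "\<phi> x y < p"
          using p d0 unfolding frequently_at by blast
        obtain s t where "s < t" "x \<in> {s..t}" "t - s = \<bar>y - x\<bar>" "f t - f s = \<phi> x y * (t - s)"
          using secant[OF y(1)] by blast
        then show ?thesis using y by (intro exI[of _ s] exI[of _ t]) (auto simp: dist_real_def)
      qed
      moreover have "\<exists>s t. s < t \<and> x \<in> {s..t} \<and> t - s < d \<and> f t - f s > q * (t - s)" if d0: "d > 0" for d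
      proof -
        obtain y where y: "y \<noteq> x" "dist y x < d" "\<phi> x y > q"
          using q d0 unfolding frequently_at by blast
        obtain s t where "s < t" "x \<in> {s..t}" "t - s = \<bar>y - x\<bar>" "f t - f s = \<phi> x y * (t - s)"
          using secant[OF y(1)] by blast
        then show ?thesis using y by (intro exI[of _ s] exI[of _ t]) (auto simp: dist_real_def)
      qed
      ultimately have "x \<in> E p q" using xab by (auto simp: E_def)
      then show False using x(2) pq by blast
    qed
    \<comment> \<open>\<open>Sup S\<close> is the lower limit of the difference quotients at
      x.\<close>
    define S where "S = {p. \<forall>\<^sub>F y in at x. p \<le> \<phi> x y}"
    have "- real n \<in> S" unfolding S_def using ev by (auto elim!: eventually_mono)
    then have "S \<noteq> {}" by auto
    have Sb: "bdd_above S"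
    proof (rule bdd_aboveI)
      fix p assume "p \<in> S"
      then have "\<forall>\<^sub>F y in at x. p \<le> \<phi> x y \<and> \<bar>\<phi> x y\<bar> \<le> n"
        using ev unfolding S_def by (simp add: eventually_conj)
      then obtain y where "p \<le> \<phi> x y" "\<bar>\<phi> x y\<bar> \<le> n"
        using eventually_happens'[OF at_neq_bot] by blast
      then show "p \<le> real n" by simp
    qed
    have "(\<phi> x \<longlongrightarrow> Sup S) (at x)"
    proof (rule order_tendstoI)
      fix u assume "u < Sup S"
      then obtain p where "p \<in> S" "u < p" using less_cSupD[OF \<open>S \<noteq> {}\<close>] by blast
      then show "\<forall>\<^sub>F y in at x. u < \<phi> x y" unfolding S_def by (auto elim!: eventually_mono)
    next
      fix u assume "Sup S < u"
      then obtain q where q: "q \<in> \<rat>" "Sup S < q" "q < u" using Rats_dense_in_real by blast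
      then obtain p where p: "p \<in> \<rat>" "Sup S < p" "p < q" using Rats_dense_in_real by blast
      \<comment> \<open>Above the lower limit, p is undercut at arbitrarily small distances. By
        \<open>gap\<close> the quotients then cannot exceed q frequently.\<close>
      have "p \<notin> S" using cSup_upper[OF _ Sb] p(2) by fastforce
      then have "\<exists>\<^sub>F y in at x. \<phi> x y < p"
        by (simp add: S_def frequently_def not_less)
      then have "\<not> (\<exists>\<^sub>F y in at x. \<phi> x y > q)" using gap[of p q] p q by (auto simp: PQ_def)
      then show "\<forall>\<^sub>F y in at x. \<phi> x y < u"
        using q(3) by (auto simp: frequently_def elim!: eventually_mono)
    qed
    then have "(f has_field_derivative Sup S) (at x)"
      by (simp add: has_field_derivative_iff \<phi>_def[abs_def])
    then show ?thesis using real_differentiable_def by blast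
  qed
  then show ?thesis by (intro negligible_subset[OF neg]) blast
qed

lemma abs_continuous_differentiable_ae:
  fixes c :: "real \<Rightarrow> 'a::euclidean_space"
  assumes ac: "abs_continuous_curve a b c"
  shows "negligible {t \<in> {a..b}. \<not> c differentiable at t}"
proof -
  have "abs_continuous_curve a b (\<lambda>t. c t \<bullet> i)" if "i \<in> Basis" for i
    using that by (intro abs_continuous_curve_dominated[OF ac, of _ 1])
      (simp add: inner_diff_left[symmetric] Basis_le_norm)
  then have "negligible (\<Union>i\<in>Basis. {t \<in> {a..b}. \<not> (\<lambda>t. c t \<bullet> i) differentiable at t})"
    by (intro negligible_Union) (auto simp del: atLeastAtMost_iff intro: abs_continuous_differentiable_ae_real)
  then show ?thesis
    by (rule negligible_subset) (auto simp: differentiable_componentwise_within[of c _ UNIV])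
qed

section \<open>The fundamental theorem of calculus for absolutely continuous functions\<close>

text \<open>In gauge form integrability of \<open>f'\<close> is part of the outcome. At tags outside
  \<open>N\<close> differentiability bounds the error on an interval by \<open>e'\<close> times its
  length. At tags in \<open>N\<close> the gauge confines the intervals to an open set of measure
  below \<delta>, where absolute continuity makes the increments small.\<close>

lemma has_integral_abs_continuous:
  fixes f :: "real \<Rightarrow> real"
  assumes "a \<le> b" and ac: "abs_continuous_curve a b f" and N: "negligible N"
    and der: "\<And>t. t \<in> {a..b} - N \<Longrightarrow> (f has_vector_derivative f' t) (at t)"
  shows "(f' has_integral (f b - f a)) {a..b}"
proof -
  \<comment> \<open>The value 0 on \<open>N\<close> removes the terms tagged there from the Riemann
    sum, so only the increments of \<open>f\<close> remain to be bounded.\<close>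
  define h where "h t = (if t \<in> N then 0 else f' t)" for t
  have "(h has_integral (f b - f a)) {a..b}"
    unfolding has_integral_real
  proof (intro allI impI)
    fix e :: real assume "e > 0"
    \<comment> \<open>The summand 1 keeps the denominator positive when a = b.\<close>
    define e' where "e' = e / (2 * (b - a + 1))"
    have e': "e' > 0" "e' * (b - a) < e / 2"
      using \<open>e > 0\<close> \<open>a \<le> b\<close> by (auto simp: e'_def field_simps add_pos_nonneg)
    have "e / 2 > 0" using \<open>e > 0\<close> by simp
    then obtain \<delta> where \<delta>: "\<delta> > 0" "\<And>D. D division_of \<Union>D \<Longrightarrow> \<Union>D \<subseteq> {a..b} \<Longrightarrow> measure lebesgue (\<Union>D) < \<delta> \<Longrightarrow>
       (\<Sum>I\<in>D. norm (increment f I)) < e / 2"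
      using abs_continuous_curveD[OF ac] by blast
    obtain U where U: "open U" "N \<subseteq> U" "U \<in> lmeasurable" "measure lebesgue U < \<delta>"
      using lmeasurable_outer_open[of N \<delta>] N \<delta>(1) negligible_imp_measurable negligible_imp_measure0
      by (metis add_0)
    have "\<exists>d>0. (t \<in> N \<longrightarrow> ball t d \<subseteq> U) \<and> (t \<in> {a..b} - N \<longrightarrow>
       (\<forall>y. \<bar>y - t\<bar> < d \<longrightarrow> \<bar>f y - f t - (y - t) * f' t\<bar> \<le> e' * \<bar>y - t\<bar>))" for t
    proof (cases "t \<in> N")
      case True
      then show ?thesis using U openE by blast
    next
      case False
      show ?thesis
      proof (cases "t \<in> {a..b}")
        case True
        then have "(f has_derivative (\<lambda>x. x *\<^sub>R f' t)) (at t)"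
          using der[of t] False by (simp add: has_vector_derivative_def)
        then show ?thesis using False e'(1) unfolding has_derivative_at_alt by auto
      qed (use False in \<open>auto intro: exI[of _ 1]\<close>)
    qed
    then obtain d where d: "\<And>t. d t > 0" "\<And>t. t \<in> N \<Longrightarrow> ball t (d t) \<subseteq> U"
       "\<And>t y. t \<in> {a..b} - N \<Longrightarrow> \<bar>y - t\<bar> < d t \<Longrightarrow> \<bar>f y - f t - (y - t) * f' t\<bar> \<le> e' * \<bar>y - t\<bar>"
      by metis
    show "\<exists>\<gamma>. gauge \<gamma> \<and> (\<forall>\<D>. \<D> tagged_division_of {a..b} \<and> \<gamma> fine \<D> \<longrightarrow>
           norm ((\<Sum>(x, k)\<in>\<D>. measure lborel k *\<^sub>R h x) - (f b - f a)) < e)"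
    proof (intro exI[of _ "\<lambda>t. ball t (d t)"] conjI allI impI)
      show "gauge (\<lambda>t. ball t (d t))" using d(1) by (intro gauge_ball_dependent) blast
      fix p assume p: "p tagged_division_of {a..b} \<and> (\<lambda>t. ball t (d t)) fine p"
      then have ptag: "p tagged_division_of {a..b}" and fine: "(\<lambda>t. ball t (d t)) fine p" by auto
      note fin = tagged_division_ofD(1)[OF ptag]
      define A where "A = {(x, k) \<in> p. x \<in> N}"
      have Ap: "A \<subseteq> p" by (auto simp: A_def)
      have k: "\<exists>u v. k = {u..v} \<and> u \<le> x \<and> x \<le> v \<and> u \<le> v \<and> k \<subseteq> ball x (d x) \<and> k \<subseteq> {a..b}" if xk: "(x, k) \<in> p" for x k
      proof -
        have "x \<in> k" "k \<subseteq> {a..b}" "k \<subseteq> ball x (d x)"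
          using tagged_division_ofD(2,3)[OF ptag xk] fineD[OF fine xk] by auto
        moreover obtain u v where "k = {u..v}" using tagged_division_ofD(4)[OF ptag xk] by auto
        ultimately show ?thesis by force
      qed
      have "\<bar>\<Sum>(x, k)\<in>p - A. measure lborel k *\<^sub>R h x - increment f k\<bar> \<le> (\<Sum>(x, k)\<in>p - A. e' * (Sup k - Inf k))"
        unfolding real_norm_def[symmetric]
      proof (rule sum_norm_le, safe)
        fix x k assume xk: "(x, k) \<in> p" "(x, k) \<notin> A"
        obtain u v where uv: "k = {u..v}" "u \<le> x" "x \<le> v" "u \<le> v" "k \<subseteq> ball x (d x)" "k \<subseteq> {a..b}"
          using k[OF xk(1)] by blast
        have xN: "x \<in> {a..b} - N" using xk uv by (auto simp: A_def)
        have "u \<in> k" "v \<in> k" using uv(1,4) by auto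
        then have "u \<in> ball x (d x)" "v \<in> ball x (d x)" using uv(5) by blast+
        then have "\<bar>f u - f x - (u - x) * f' x\<bar> \<le> e' * \<bar>u - x\<bar>" "\<bar>f v - f x - (v - x) * f' x\<bar> \<le> e' * \<bar>v - x\<bar>"
          by (intro d(3)[OF xN]; simp add: dist_real_def abs_minus_commute)+
        moreover have "measure lborel k *\<^sub>R h x - increment f k =
          (f u - f x - (u - x) * f' x) - (f v - f x - (v - x) * f' x)"
          using uv xN by (simp add: h_def algebra_simps)
        moreover have "e' * \<bar>u - x\<bar> + e' * \<bar>v - x\<bar> = e' * (Sup k - Inf k)"
          using uv by (simp add: algebra_simps)
        ultimately show "norm (measure lborel k *\<^sub>R h x - increment f k) \<le> e' * (Sup k - Inf k)"
          unfolding real_norm_def by linarith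
      qed
      also have "\<dots> \<le> (\<Sum>(x, k)\<in>p. e' * (Sup k - Inf k))"
      proof (rule sum_mono2[OF fin])
        fix z assume "z \<in> p - (p - A)"
        then obtain x k' where z: "z = (x, k')" "(x, k') \<in> p" by (cases z) auto
        then obtain u v where "k' = {u..v}" "u \<le> v" using k by blast
        then show "0 \<le> (case z of (x, k) \<Rightarrow> e' * (Sup k - Inf k))" using z e'(1) by simp
      qed auto
      also have "\<dots> = e' * (b - a)"
        using additive_tagged_division_1[OF \<open>a \<le> b\<close> ptag, of "\<lambda>x. x"]
        by (simp add: sum_distrib_left[symmetric] case_prod_unfold)
      finally have 1: "\<bar>\<Sum>(x, k)\<in>p - A. measure lborel k *\<^sub>R h x - increment f k\<bar> < e / 2" using e'(2) by simp
      have tagA: "A tagged_partial_division_of {a..b}"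
        using tagged_partial_division_subset[OF _ Ap] ptag by (auto simp: tagged_division_of_def)
      have divA: "snd ` A division_of \<Union>(snd ` A)"
        using partial_division_of_tagged_division[OF tagA] .
      have AU: "\<Union>(snd ` A) \<subseteq> U"
        using k d(2) unfolding A_def by fastforce
      have "measure lebesgue (\<Union>(snd ` A)) \<le> measure lebesgue U"
        using AU U lmeasurable_division[OF divA] by (intro measure_mono_fmeasurable) auto
      moreover have "\<Union>(snd ` A) \<subseteq> {a..b}" using k Ap by fastforce
      ultimately have "(\<Sum>I\<in>snd ` A. norm (increment f I)) < e / 2" using U(4) by (intro \<delta>(2)[OF divA]) auto
      moreover have "(\<Sum>(x, k)\<in>A. norm (increment f k)) = (\<Sum>I\<in>snd ` A. norm (increment f I))"
      proof -
        \<comment> \<open>Tags may share an interval only if its interior is empty, so passing to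
          the untagged sum requires the value 0 on all such intervals. For one-point intervals this
          is automatic; for the empty one \<open>Sup\<close> and \<open>Inf\<close> are unspecified,
          hence the case distinction.\<close>
        define w where "w k = (if k = {} then 0 else norm (increment f k))" for k
        have "(\<Sum>(x, k)\<in>A. w k) = (\<Sum>I\<in>snd ` A. w I)"
          by (rule sum.over_tagged_division_lemma[OF tagged_partial_division_of_Union_self[OF tagA]])
            (auto simp: w_def)
        moreover have "(\<Sum>(x, k)\<in>A. w k) = (\<Sum>(x, k)\<in>A. norm (increment f k))"
          using division_ofD(3)[OF divA] by (intro sum.cong) (force simp: w_def)+
        moreover have "(\<Sum>I\<in>snd ` A. w I) = (\<Sum>I\<in>snd ` A. norm (increment f I))"
          using division_ofD(3)[OF divA] by (intro sum.cong) (auto simp: w_def)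
        ultimately show ?thesis by simp
      qed
      moreover have "\<bar>\<Sum>(x, k)\<in>A. measure lborel k *\<^sub>R h x - increment f k\<bar> \<le> (\<Sum>(x, k)\<in>A. norm (increment f k))"
        unfolding real_norm_def[symmetric]
        by (rule sum_norm_le) (auto simp: A_def h_def)
      ultimately have 2: "\<bar>\<Sum>(x, k)\<in>A. measure lborel k *\<^sub>R h x - increment f k\<bar> < e / 2" by simp
      have "(\<Sum>(x, k)\<in>p. measure lborel k *\<^sub>R h x) - (f b - f a) = (\<Sum>(x, k)\<in>p. measure lborel k *\<^sub>R h x - increment f k)"
        using additive_tagged_division_1[OF \<open>a \<le> b\<close> ptag, of f]
        by (simp add: sum_subtractf case_prod_unfold)
      also have "\<dots> = (\<Sum>(x, k)\<in>p - A. measure lborel k *\<^sub>R h x - increment f k) + (\<Sum>(x, k)\<in>A. measure lborel k *\<^sub>R h x - increment f k)"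
        by (rule sum.subset_diff[OF Ap fin])
      finally show "norm ((\<Sum>(x, k)\<in>p. measure lborel k *\<^sub>R h x) - (f b - f a)) < e"
        using 1 2 by simp
    qed
  qed
  then show ?thesis
    by (rule has_integral_spike[OF N, rotated]) (auto simp: h_def)
qed

text \<open>A gauge integral may converge only conditionally, but then the right side is infinite.
  If it is finite, \<open>h\<close> is absolutely integrable and the gauge integral is the Lebesgue
  integral.\<close>

lemma ennreal_integral_le_nn_integral_abs:
  fixes h :: "real \<Rightarrow> real"
  assumes "(h has_integral I) {a..b}"
  shows "ennreal I \<le> (\<integral>\<^sup>+t\<in>{a..b}. ennreal \<bar>h t\<bar> \<partial>lebesgue)" (is "_ \<le> ?N")
proof (cases "?N = \<infinity>")
  case False
  have "(\<lambda>x. indicator {a..b} x *\<^sub>R h x) \<in> borel_measurable lebesgue"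
    using assms by (rule has_integral_implies_lebesgue_measurable)
  moreover have N: "?N = (\<integral>\<^sup>+t. ennreal (norm (indicator {a..b} t *\<^sub>R h t)) \<partial>lebesgue)"
    by (intro nn_integral_cong) (auto simp: indicator_def)
  ultimately have int: "integrable lebesgue (\<lambda>x. indicator {a..b} x *\<^sub>R h x)"
    using False by (intro integrableI_bounded) (auto simp: less_top)
  then have "set_integrable lebesgue {a..b} h" by (simp add: set_integrable_def)
  then have "I = integral\<^sup>L lebesgue (\<lambda>x. indicator {a..b} x *\<^sub>R h x)"
    using set_lebesgue_integral_eq_integral(2)[of "{a..b}" h] assms
    by (simp add: set_lebesgue_integral_def integral_unique)
  also have "\<dots> \<le> integral\<^sup>L lebesgue (\<lambda>x. norm (indicator {a..b} x *\<^sub>R h x))"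
    using int by (intro integral_mono) auto
  finally have "ennreal I \<le> ennreal (integral\<^sup>L lebesgue (\<lambda>x. norm (indicator {a..b} x *\<^sub>R h x)))"
    by (rule ennreal_leI)
  also have "\<dots> = ?N"
    unfolding N using int by (intro nn_integral_eq_integral[symmetric]) auto
  finally show ?thesis .
qed simp

lemma abs_continuous_imp_continuous_on:
  fixes f :: "real \<Rightarrow> 'a::real_normed_vector"
  assumes "abs_continuous_curve a b f"
  shows "continuous_on {a..b} f"
  unfolding continuous_on_iff
proof (intro ballI allI impI)
  fix x \<epsilon> :: real assume x: "x \<in> {a..b}" and "\<epsilon> > 0"
  obtain \<delta> where "\<delta> > 0" and \<delta>: "\<And>D. D division_of \<Union>D \<Longrightarrow> \<Union>D \<subseteq> {a..b} \<Longrightarrow> measure lebesgue (\<Union>D) < \<delta> \<Longrightarrow>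
       (\<Sum>I\<in>D. norm (increment f I)) < \<epsilon>"
    using abs_continuous_curveD[OF assms \<open>\<epsilon> > 0\<close>] by blast
  have "dist (f y) (f x) < \<epsilon>" if y: "y \<in> {a..b}" "dist y x < \<delta>" for y
  proof -
    define s t where "s = min x y" and "t = max x y"
    have st: "s \<le> t" "a \<le> s" "t \<le> b" "t - s < \<delta>"
      using x y by (auto simp: s_def t_def dist_real_def)
    have "norm (f t - f s) < \<epsilon>"
      using \<delta>[of "{{s..t}}"] st division_of_self[of s t] by simp
    then show ?thesis
      by (auto simp: s_def t_def dist_norm norm_minus_commute min_def max_def split: if_splits)
  qed
  then show "\<exists>d>0. \<forall>x'\<in>{a..b}. dist x' x < d \<longrightarrow> dist (f x') (f x) < \<epsilon>"
    using \<open>\<delta> > 0\<close> by blast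
qed

subsection \<open>The potential\<close>

lemma Ck_on_cong:
  assumes "Ck_on k S f" "open S" "\<And>x. x \<in> S \<Longrightarrow> f x = g x"
  shows "Ck_on k S g"
  using assms(1,3)
proof (induction k arbitrary: f g)
  case 0
  then show ?case by (metis Ck_on.simps(1) continuous_on_cong)
next
  case (Suc k)
  have fd: "f differentiable (at x)" if "x \<in> S" for x using Suc.prems(1) that by simp
  have "Ck_on k S (\<lambda>x. frechet_derivative g (at x) v)" for v
  proof (rule Suc.IH)
    show "Ck_on k S (\<lambda>x. frechet_derivative f (at x) v)" using Suc.prems(1) by simp
    show "frechet_derivative f (at x) v = frechet_derivative g (at x) v" if "x \<in> S" for x
      using frechet_derivative_transform_within_open[OF fd assms(2)] that Suc.prems(2) by metis
  qed
  moreover have "g differentiable (at x)" if "x \<in> S" for x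
    using fd[OF that] has_derivative_transform_within_open[of f _ x UNIV S g] assms(2) that Suc.prems(2)
    unfolding differentiable_def by blast
  ultimately show ?case by simp
qed

text \<open>An algebra of functions closed under directional derivatives away from the origin.\<close>

inductive norm_expr :: "('a::euclidean_space \<Rightarrow> real) \<Rightarrow> bool" where
  const: "norm_expr (\<lambda>_. r)"
| inner: "norm_expr (\<lambda>q. q \<bullet> v)"
| inverse_norm: "norm_expr (\<lambda>q. inverse (norm q))"
| add: "norm_expr f \<Longrightarrow> norm_expr g \<Longrightarrow> norm_expr (\<lambda>q. f q + g q)"
| mult: "norm_expr f \<Longrightarrow> norm_expr g \<Longrightarrow> norm_expr (\<lambda>q. f q * g q)"

lemma norm_expr_derivative:
  assumes "norm_expr f"
  shows "\<exists>f'. (\<forall>q. q \<noteq> 0 \<longrightarrow> (f has_derivative f' q) (at q)) \<and> (\<forall>v. norm_expr (\<lambda>q. f' q v))"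
  using assms
proof induction
  case (const r)
  show ?case by (intro exI[of _ "\<lambda>_ _. 0"]) (auto intro: norm_expr.const)
next
  case (inner w)
  show ?case
    by (rule exI[of _ "\<lambda>_ v. v \<bullet> w"]) (auto intro!: norm_expr.const derivative_eq_intros)
next
  case inverse_norm
  show ?case
  proof (intro exI[of _ "\<lambda>q v. - 1 * ((q \<bullet> v) * (inverse (norm q) * (inverse (norm q) * inverse (norm q))))"]
      conjI allI impI)
    fix q :: 'a assume "q \<noteq> 0"
    then show "((\<lambda>q. inverse (norm q)) has_derivative
      (\<lambda>v. - 1 * ((q \<bullet> v) * (inverse (norm q) * (inverse (norm q) * inverse (norm q)))))) (at q)"
      by (auto intro!: derivative_eq_intros has_derivative_norm simp: sgn_div_norm inner_commute field_simps)
  qed (intro norm_expr.intros)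
next
  case (add f g)
  then obtain f' g' where
    "\<forall>q. q \<noteq> 0 \<longrightarrow> (f has_derivative f' q) (at q)" "\<forall>v. norm_expr (\<lambda>q. f' q v)"
    "\<forall>q. q \<noteq> 0 \<longrightarrow> (g has_derivative g' q) (at q)" "\<forall>v. norm_expr (\<lambda>q. g' q v)" by blast
  then show ?case
    by (intro exI[of _ "\<lambda>q v. f' q v + g' q v"]) (auto intro: norm_expr.add has_derivative_add)
next
  case (mult f g)
  then obtain f' g' where
    "\<forall>q. q \<noteq> 0 \<longrightarrow> (f has_derivative f' q) (at q)" "\<And>v. norm_expr (\<lambda>q. f' q v)"
    "\<forall>q. q \<noteq> 0 \<longrightarrow> (g has_derivative g' q) (at q)" "\<And>v. norm_expr (\<lambda>q. g' q v)" by blast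
  then show ?case
    by (intro exI[of _ "\<lambda>q v. f q * g' q v + f' q v * g q"] conjI allI impI
        norm_expr.add norm_expr.mult has_derivative_mult mult.hyps) auto
qed

lemma smooth_on_norm_expr:
  fixes f :: "'a::euclidean_space \<Rightarrow> real"
  assumes "norm_expr f"
  shows "smooth_on (- {0}) f"
proof -
  have "Ck_on k (- {0}) f" for k
    using assms
  proof (induction k arbitrary: f)
    case 0
    obtain f' where "\<forall>q. q \<noteq> 0 \<longrightarrow> (f has_derivative f' q) (at q)"
      using norm_expr_derivative[OF 0] by blast
    then show ?case
      by (auto intro!: continuous_at_imp_continuous_on has_derivative_continuous)
  next
    case (Suc k)
    obtain f' where f': "\<forall>q. q \<noteq> 0 \<longrightarrow> (f has_derivative f' q) (at q)" "\<forall>v. norm_expr (\<lambda>q. f' q v)"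
      using norm_expr_derivative[OF Suc.prems] by blast
    have "Ck_on k (- {0}) (\<lambda>x. frechet_derivative f (at x) v)" for v
    proof (rule Ck_on_cong)
      show "Ck_on k (- {0}) (\<lambda>q. f' q v)" using Suc.IH f'(2) by blast
      show "f' x v = frechet_derivative f (at x) v" if "x \<in> - {0}" for x
        using frechet_derivative_at[of f "f' x" x] f'(1) that by simp
    qed auto
    then show ?case using f'(1) by (auto simp: differentiable_def)
  qed
  then show ?thesis by (simp add: smooth_on_def)
qed

text \<open>\<open>kepler_U e\<close> is half the squared norm of the gradient of \<open>action_fun e\<close>.\<close>

definition action_fun :: "'a::euclidean_space \<Rightarrow> 'a \<Rightarrow> real" where
  "action_fun e q = (q \<bullet> e) / sqrt (norm q)"

definition kepler_U :: "'a::euclidean_space \<Rightarrow> 'a \<Rightarrow> real" where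
  "kepler_U e q = inverse (norm q) / 2 - 3 / 8 * (q \<bullet> e)\<^sup>2 * inverse (norm q) ^ 3"

definition kepler_V :: "'a::euclidean_space \<Rightarrow> 'a \<Rightarrow> ereal" where
  "kepler_V e q = (if q = 0 then - \<infinity> else ereal (- kepler_U e q))"

context
  fixes e :: "'a::euclidean_space"
  assumes e: "norm e = 1"
begin

lemma inner_sq_le: "(q \<bullet> e)\<^sup>2 \<le> (norm q)\<^sup>2"
  using Cauchy_Schwarz_ineq2[of q e] e by (metis abs_ge_zero mult.right_neutral power2_abs power_mono)

text \<open>Cauchy-Schwarz leaves 1/2 - 3/8 = 1/8. With \<theta> the angle between q and e, U is (4
  - 3 cos^2 \<theta>) / (8 |q|), smallest on the line of e.\<close>

lemma kepler_U_ge: "q \<noteq> 0 \<Longrightarrow> kepler_U e q \<ge> inverse (norm q) / 8"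
proof -
  assume "q \<noteq> 0"
  have "(q \<bullet> e)\<^sup>2 * inverse (norm q) ^ 3 \<le> (norm q)\<^sup>2 * inverse (norm q) ^ 3"
    by (intro mult_right_mono inner_sq_le) auto
  also have "\<dots> = inverse (norm q)" using \<open>q \<noteq> 0\<close> by (simp add: field_simps power2_eq_square power3_eq_cube)
  finally show ?thesis by (simp add: kepler_U_def mult.commute)
qed

lemma kepler_U_pos: "q \<noteq> 0 \<Longrightarrow> kepler_U e q > 0"
  by (rule less_le_trans[OF _ kepler_U_ge]) auto

lemma kepler_U_le: "kepler_U e q \<le> inverse (norm q) / 2"
  by (simp add: kepler_U_def)

lemma smooth_kepler_V: "smooth_away_from_0 (kepler_V e)"
  unfolding smooth_away_from_0_def
proof (intro conjI allI impI)
  \<comment> \<open>Powers are spelled out because \<open>norm_expr\<close> is generated by binary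
    products.\<close>
  define f where "f q = - 1 / 2 * inverse (norm q) +
    3 / 8 * ((q \<bullet> e) * ((q \<bullet> e) * (inverse (norm q) * (inverse (norm q) * inverse (norm q)))))" for q :: 'a
  have "norm_expr f" unfolding f_def by (intro norm_expr.intros)
  then have "Ck_on k (- {0}) f" for k using smooth_on_norm_expr by (auto simp: smooth_on_def)
  then have "Ck_on k (- {0}) (\<lambda>q. real_of_ereal (kepler_V e q))" for k
    by (rule Ck_on_cong) (auto simp: f_def kepler_V_def kepler_U_def power2_eq_square power3_eq_cube)
  then show "smooth_on (- {0}) (\<lambda>q. real_of_ereal (kepler_V e q))" by (simp add: smooth_on_def)
qed (simp add: kepler_V_def)

lemma continuous_kepler_V: "continuous_on UNIV (kepler_V e)"
proof (rule continuous_at_imp_continuous_on, rule ballI)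
  fix q :: 'a
  show "isCont (kepler_V e) q"
  proof (cases "q = 0")
    case False
    have "continuous_on (- {0}) (\<lambda>q. ereal (- kepler_U e q))"
      unfolding kepler_U_def by (intro continuous_intros) auto
    then have "continuous_on (- {0}) (kepler_V e)"
      by (rule continuous_on_eq) (auto simp: kepler_V_def)
    then show ?thesis using False by (simp add: continuous_on_eq_continuous_at open_Compl)
  next
    case True
    have "(kepler_V e \<longlongrightarrow> - \<infinity>) (at 0)"
      unfolding tendsto_MInfty
    proof
      fix r :: real
      \<comment> \<open>The radius is chosen such that the lower bound
        \<open>inverse (norm q) / 8\<close> exceeds \<open>\<bar>r\<bar> + 1\<close>.\<close>
      have "kepler_V e q < ereal r" if "q \<noteq> 0" "dist q 0 < inverse (8 * (\<bar>r\<bar> + 1))" for q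
      proof -
        have "8 * (\<bar>r\<bar> + 1) = inverse (inverse (8 * (\<bar>r\<bar> + 1)))" by simp
        also have "\<dots> < inverse (norm q)" using that by (intro less_imp_inverse_less) auto
        finally have "\<bar>r\<bar> + 1 < inverse (norm q) / 8" by simp
        also have "\<dots> \<le> kepler_U e q" by (rule kepler_U_ge[OF that(1)])
        finally have "\<bar>r\<bar> + 1 < kepler_U e q" .
        then show ?thesis using that(1) by (simp add: kepler_V_def)
      qed
      then show "\<forall>\<^sub>F q in at 0. kepler_V e q < ereal r"
        unfolding eventually_at by (intro exI[of _ "inverse (8 * (\<bar>r\<bar> + 1))"]) auto
    qed
    then show ?thesis using True by (simp add: isCont_def kepler_V_def)
  qed
qed

lemma homogeneous_kepler_V: "homogeneous_of_degree (- 1) (kepler_V e)"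
  by (auto simp: homogeneous_of_degree_def kepler_V_def kepler_U_def powr_minus field_simps
      power2_eq_square power3_eq_cube)

lemma kepler_V_neg: "kepler_V e q < 0"
  using kepler_U_pos by (simp add: kepler_V_def)

lemma neg_potential_kepler_V:
  "neg_potential (kepler_V e) q = (if q = 0 then \<infinity> else ennreal (kepler_U e q))"
  by (simp add: neg_potential_def kepler_V_def e2ennreal_infty e2ennreal_ereal infinity_ennreal_def)

lemma esqrt_kepler_V:
  "q \<noteq> 0 \<Longrightarrow> esqrt (2 * neg_potential (kepler_V e) q) = ennreal (sqrt (2 * kepler_U e q))"
  using kepler_U_pos[of q]
  by (simp add: neg_potential_kepler_V esqrt_def ennreal_mult_eq_top_iff enn2real_mult)

text \<open>This includes the origin, where division by zero yields 0, the continuous extension of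
  \<open>action_fun e\<close>.\<close>

lemma abs_action_fun_le: "\<bar>action_fun e q\<bar> \<le> sqrt (norm q)"
proof (cases "q = 0")
  case False
  have "\<bar>q \<bullet> e\<bar> \<le> sqrt (norm q) * sqrt (norm q)"
    using Cauchy_Schwarz_ineq2[of q e] e by simp
  then show ?thesis using False by (simp add: action_fun_def pos_divide_le_eq)
qed (simp add: action_fun_def)

definition action_fun_grad :: "'a \<Rightarrow> 'a" where
  "action_fun_grad q = (1 / sqrt (norm q)) *\<^sub>R e - ((q \<bullet> e) / (2 * sqrt (norm q) * (norm q)\<^sup>2)) *\<^sub>R q"

lemma action_fun_has_derivative:
  assumes "q \<noteq> 0"
  shows "(action_fun e has_derivative (\<lambda>v. action_fun_grad q \<bullet> v)) (at q)"
proof -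
  have s: "sqrt (norm q) * sqrt (norm q) = norm q" by simp
  have "(action_fun e has_derivative (\<lambda>v. (v \<bullet> e) / sqrt (norm q)
      - (q \<bullet> e) * ((v \<bullet> sgn q) / (2 * sqrt (norm q))) / (sqrt (norm q) * sqrt (norm q)))) (at q)"
    unfolding action_fun_def[abs_def] using assms
    by (auto intro!: derivative_eq_intros has_derivative_norm simp: inner_commute divide_simps)
  moreover have "(v \<bullet> e) / sqrt (norm q)
      - (q \<bullet> e) * ((v \<bullet> sgn q) / (2 * sqrt (norm q))) / (sqrt (norm q) * sqrt (norm q)) = action_fun_grad q \<bullet> v" for v
  proof -
    have "v \<bullet> sgn q = (q \<bullet> v) / norm q"
      by (simp add: sgn_div_norm inner_commute divide_inverse_commute)
    moreover have "action_fun_grad q \<bullet> v = (v \<bullet> e) / sqrt (norm q) - (q \<bullet> e) / (2 * sqrt (norm q) * (norm q)\<^sup>2) * (q \<bullet> v)"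
      by (simp add: action_fun_grad_def inner_diff_left inner_diff_right inner_commute)
    ultimately show ?thesis unfolding s using assms by (simp add: power2_eq_square)
  qed
  ultimately show ?thesis by simp
qed

text \<open>This is where 3/8 comes from: in the squared norm the cross term contributes -1 and the
  square of the radial term 1/4 to the coefficient of (q . e)^2 / |q|^3, in total -3/4, which is
  halved in \<open>kepler_U\<close>. Writing |q| as a square makes the computation rational.\<close>

lemma norm_action_fun_grad:
  assumes "q \<noteq> 0"
  shows "norm (action_fun_grad q) = sqrt (2 * kepler_U e q)"
proof -
  define r where "r = sqrt (norm q)"
  have r: "r > 0" "norm q = r\<^sup>2" using assms by (auto simp: r_def)
  have ee: "e \<bullet> e = 1" and qq: "q \<bullet> q = r ^ 4" 
    using e r by (auto simp: dot_square_norm simp flip: power_mult)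
  have "(norm (action_fun_grad q))\<^sup>2 = 2 * kepler_U e q"
    unfolding action_fun_grad_def kepler_U_def power2_norm_eq_inner r_def[symmetric] r(2) 
    using r(1) by (simp add: inner_diff_left inner_diff_right ee qq inner_commute field_simps eval_nat_numeral)
  then show ?thesis by (metis norm_ge_zero real_sqrt_unique)
qed

end

subsection \<open>Calibration\<close>

text \<open>\<open>action_fun e\<close> grows like \<open>sqrt (norm q)\<close> at the origin, hence is not differentiable there. Composing
  it with \<open>damp \<epsilon>\<close>, which is cubic at \<open>0\<close> and has derivative in \<open>[0, 1)\<close>, removes the singularity
  without increasing the gradient, so curves through the collision need no separate treatment.\<close>

definition damp :: "real \<Rightarrow> real \<Rightarrow> real" where
  "damp \<epsilon> s = s - \<epsilon> * arctan (s / \<epsilon>)"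

lemma damp_has_derivative:
  assumes "\<epsilon> > 0"
  shows "(damp \<epsilon> has_field_derivative s\<^sup>2 / (s\<^sup>2 + \<epsilon>\<^sup>2)) (at s)"
proof -
  have p: "\<epsilon>\<^sup>2 + s\<^sup>2 > 0" using assms by (simp add: add_pos_nonneg)
  have "1 - \<epsilon> * (inverse (1 + (s / \<epsilon>)\<^sup>2) * (1 / \<epsilon>)) = s\<^sup>2 / (s\<^sup>2 + \<epsilon>\<^sup>2)"
    using assms p by (simp add: field_simps power2_eq_square)
  moreover have "(damp \<epsilon> has_field_derivative 1 - \<epsilon> * (inverse (1 + (s / \<epsilon>)\<^sup>2) * (1 / \<epsilon>))) (at s)"
    unfolding damp_def[abs_def] using assms by (auto intro!: derivative_eq_intros simp: power2_eq_square)
  ultimately show ?thesis by simp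
qed

text \<open>On [-|s|, |s|] the derivative is at most s^2 / \<epsilon>^2. With |S q| at most sqrt
  |q|, the damped function is of order |q|^(3/2), hence differentiable at 0 with derivative
  0.\<close>

lemma abs_damp_le:
  assumes "\<epsilon> > 0"
  shows "\<bar>damp \<epsilon> s\<bar> \<le> s\<^sup>2 / \<epsilon>\<^sup>2 * \<bar>s\<bar>"
proof -
  have "\<bar>damp \<epsilon> s - damp \<epsilon> 0\<bar> \<le> s\<^sup>2 / \<epsilon>\<^sup>2 * \<bar>s - 0\<bar>"
    unfolding real_norm_def[symmetric]
  proof (rule field_differentiable_bound[of "{- \<bar>s\<bar>..\<bar>s\<bar>}"])
    fix z assume z: "z \<in> {- \<bar>s\<bar>..\<bar>s\<bar>}"
    show "(damp \<epsilon> has_field_derivative z\<^sup>2 / (z\<^sup>2 + \<epsilon>\<^sup>2)) (at z within {- \<bar>s\<bar>..\<bar>s\<bar>})"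
      using damp_has_derivative[OF assms] by (rule has_field_derivative_at_within)
    have "z\<^sup>2 \<le> s\<^sup>2" using z by (auto simp: abs_le_square_iff[symmetric])
    then have "z\<^sup>2 / (z\<^sup>2 + \<epsilon>\<^sup>2) \<le> s\<^sup>2 / \<epsilon>\<^sup>2"
      using assms by (intro frac_le) auto
    then show "norm (z\<^sup>2 / (z\<^sup>2 + \<epsilon>\<^sup>2)) \<le> s\<^sup>2 / \<epsilon>\<^sup>2" by simp
  qed auto
  then show ?thesis by (simp add: damp_def)
qed

context
  fixes e :: "'a::euclidean_space" and \<epsilon> :: real
  assumes e: "norm e = 1" and \<epsilon>: "\<epsilon> > 0"
begin

definition damped_grad :: "'a \<Rightarrow> 'a" where
  "damped_grad q = (if q = 0 then 0 else
     ((action_fun e q)\<^sup>2 / ((action_fun e q)\<^sup>2 + \<epsilon>\<^sup>2)) *\<^sub>R action_fun_grad e q)"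

lemma damped_has_derivative:
  "((\<lambda>q. damp \<epsilon> (action_fun e q)) has_derivative (\<lambda>v. damped_grad q \<bullet> v)) (at q)"
proof (cases "q = 0")
  case False
  have "((\<lambda>q. damp \<epsilon> (action_fun e q)) has_derivative
     (\<lambda>v. (action_fun_grad e q \<bullet> v) * ((action_fun e q)\<^sup>2 / ((action_fun e q)\<^sup>2 + \<epsilon>\<^sup>2)))) (at q)"
    by (rule DERIV_compose_FDERIV[OF damp_has_derivative[OF \<epsilon>] action_fun_has_derivative[OF e False]])
  then show ?thesis using False by (simp add: damped_grad_def mult.commute)
next
  case True
  have "((\<lambda>q. damp \<epsilon> (action_fun e q)) has_derivative (\<lambda>v. 0)) (at 0)"
    unfolding has_derivative_at
  proof (intro conjI)
    have lim: "((\<lambda>v. sqrt (norm v) / \<epsilon>\<^sup>2) \<longlongrightarrow> 0) (at (0::'a))"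
      using \<epsilon> by (auto intro!: tendsto_eq_intros)
    show "((\<lambda>v. norm (damp \<epsilon> (action_fun e (0 + v)) - damp \<epsilon> (action_fun e 0) - 0) / norm v) \<longlongrightarrow> 0) (at 0)"
    proof (rule tendsto_sandwich[OF _ _ tendsto_const lim])
      have "norm (damp \<epsilon> (action_fun e (0 + v)) - damp \<epsilon> (action_fun e 0) - 0) / norm v \<le> sqrt (norm v) / \<epsilon>\<^sup>2"
        if "v \<noteq> 0" for v
      proof -
        define s where "s = action_fun e v"
        have s: "\<bar>s\<bar> \<le> sqrt (norm v)" unfolding s_def by (rule abs_action_fun_le[OF e])
        then have "s\<^sup>2 \<le> (sqrt (norm v))\<^sup>2" by (metis abs_ge_zero power2_abs power_mono)
        then have s2: "s\<^sup>2 \<le> norm v" by simp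
        have "\<bar>damp \<epsilon> s\<bar> \<le> s\<^sup>2 / \<epsilon>\<^sup>2 * \<bar>s\<bar>" by (rule abs_damp_le[OF \<epsilon>])
        also have "\<dots> \<le> norm v / \<epsilon>\<^sup>2 * sqrt (norm v)"
          using s s2 by (intro mult_mono divide_right_mono) auto
        finally have "\<bar>damp \<epsilon> s\<bar> / norm v \<le> norm v / \<epsilon>\<^sup>2 * sqrt (norm v) / norm v"
          by (intro divide_right_mono) auto
        then show ?thesis using that by (simp add: s_def action_fun_def damp_def)
      qed
      then show "\<forall>\<^sub>F v in at 0. norm (damp \<epsilon> (action_fun e (0 + v)) - damp \<epsilon> (action_fun e 0) - 0) / norm v \<le> sqrt (norm v) / \<epsilon>\<^sup>2"
        by (simp add: eventually_at_filter)
    qed auto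
  qed simp
  then show ?thesis using True by (simp add: damped_grad_def)
qed

lemma norm_damped_grad_le:
  "q \<noteq> 0 \<Longrightarrow> norm (damped_grad q) \<le> sqrt (2 * kepler_U e q)"
proof -
  assume q: "q \<noteq> 0"
  define s where "s = action_fun e q"
  have "s\<^sup>2 / (s\<^sup>2 + \<epsilon>\<^sup>2) \<le> 1" by (intro divide_le_eq_1_pos[THEN iffD2]) (use \<epsilon> in \<open>auto intro: add_nonneg_pos\<close>)
  then have "s\<^sup>2 / (s\<^sup>2 + \<epsilon>\<^sup>2) * sqrt (2 * kepler_U e q) \<le> 1 * sqrt (2 * kepler_U e q)"
    using kepler_U_pos[OF e q] by (intro mult_right_mono) auto
  then show ?thesis
    using norm_action_fun_grad[OF e q] q by (simp add: damped_grad_def s_def)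
qed

text \<open>The damping factor, at most |q| / \<epsilon>^2, outweighs the growth |q|^(-1/2) of the
  gradient. The resulting local Lipschitz bound makes the damped function absolutely continuous
  along every absolutely continuous curve, collisions included.\<close>

lemma norm_damped_grad_le':
  "norm (damped_grad q) \<le> sqrt (norm q) / \<epsilon>\<^sup>2"
proof (cases "q = 0")
  case q: False
  define s where "s = action_fun e q"
  have "\<bar>s\<bar> \<le> sqrt (norm q)" unfolding s_def by (rule abs_action_fun_le[OF e])
  then have "s\<^sup>2 \<le> (sqrt (norm q))\<^sup>2" by (metis abs_ge_zero power2_abs power_mono)
  then have "s\<^sup>2 / (s\<^sup>2 + \<epsilon>\<^sup>2) \<le> norm q / \<epsilon>\<^sup>2" using \<epsilon> by (intro frac_le) auto
  moreover have "sqrt (2 * kepler_U e q) \<le> sqrt (inverse (norm q))"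
    using kepler_U_le[OF e, of q] by (intro real_sqrt_le_mono) simp
  ultimately have "s\<^sup>2 / (s\<^sup>2 + \<epsilon>\<^sup>2) * sqrt (2 * kepler_U e q) \<le> norm q / \<epsilon>\<^sup>2 * sqrt (inverse (norm q))"
    using kepler_U_pos[OF e q] by (intro mult_mono) auto
  also have "\<dots> = sqrt (norm q) / \<epsilon>\<^sup>2"
    using real_div_sqrt[of "norm q"] by (simp add: real_sqrt_inverse divide_inverse mult_ac)
  finally show ?thesis
    using norm_action_fun_grad[OF e q] q by (simp add: damped_grad_def s_def)
qed (simp add: damped_grad_def)

lemma damped_Lipschitz:
  assumes "norm p \<le> M" "norm q \<le> M"
  shows "\<bar>damp \<epsilon> (action_fun e p) - damp \<epsilon> (action_fun e q)\<bar> \<le> sqrt M / \<epsilon>\<^sup>2 * norm (p - q)"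
  unfolding real_norm_def[symmetric]
proof (rule differentiable_bound[of "cball 0 M"])
  fix x :: 'a assume x: "x \<in> cball 0 M"
  show "((\<lambda>q. damp \<epsilon> (action_fun e q)) has_derivative (\<lambda>v. damped_grad x \<bullet> v)) (at x within cball 0 M)"
    using damped_has_derivative by (rule has_derivative_at_withinI)
  show "onorm (\<lambda>v. damped_grad x \<bullet> v) \<le> sqrt M / \<epsilon>\<^sup>2"
  proof (rule onorm_le)
    fix v
    have "norm (damped_grad x \<bullet> v) \<le> norm (damped_grad x) * norm v"
      by (simp add: Cauchy_Schwarz_ineq2)
    also have "\<dots> \<le> sqrt M / \<epsilon>\<^sup>2 * norm v"
      using x by (intro mult_right_mono order_trans[OF norm_damped_grad_le'] divide_right_mono) auto
    finally show "norm (damped_grad x \<bullet> v) \<le> sqrt M / \<epsilon>\<^sup>2 * norm v" .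
  qed
qed (use assms in auto)

lemma damped_le_JM_length:
  assumes "a \<le> b" and ac: "abs_continuous_curve a b \<sigma>"
  shows "ennreal (damp \<epsilon> (action_fun e (\<sigma> b)) - damp \<epsilon> (action_fun e (\<sigma> a))) \<le> JM_length (kepler_V e) a b \<sigma>"
proof -
  define g where "g t = damp \<epsilon> (action_fun e (\<sigma> t))" for t
  define g' where "g' t = damped_grad (\<sigma> t) \<bullet> vector_derivative \<sigma> (at t)" for t
  define N where "N = {t \<in> {a..b}. \<not> \<sigma> differentiable at t}"
  have N: "negligible N" unfolding N_def by (rule abs_continuous_differentiable_ae[OF ac])
  have "bounded (\<sigma> ` {a..b})"
    using abs_continuous_imp_continuous_on[OF ac] by (intro compact_imp_bounded compact_continuous_image) auto
  then obtain M where "\<forall>x\<in>\<sigma> ` {a..b}. norm x \<le> M"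
    unfolding bounded_iff by blast
  then have M: "norm (\<sigma> t) \<le> M" if "t \<in> {a..b}" for t using that by blast
  have acg: "abs_continuous_curve a b g"
    using damped_Lipschitz[OF M M]
    by (intro abs_continuous_curve_dominated[OF ac, of _ "sqrt M / \<epsilon>\<^sup>2"]) (simp add: g_def)
  have "(g has_vector_derivative g' t) (at t)" if "t \<in> {a..b} - N" for t
  proof -
    have "(\<sigma> has_vector_derivative vector_derivative \<sigma> (at t)) (at t)"
      using that by (simp add: N_def vector_derivative_works)
    then have "(\<sigma> has_derivative (\<lambda>h. h *\<^sub>R vector_derivative \<sigma> (at t))) (at t)"
      by (simp add: has_vector_derivative_def)
    from has_derivative_compose[OF this damped_has_derivative]
    show ?thesis by (simp add: g_def[abs_def] g'_def has_vector_derivative_def)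
  qed
  then have "(g' has_integral (g b - g a)) {a..b}"
    by (rule has_integral_abs_continuous[OF assms(1) acg N])
  then have "ennreal (g b - g a) \<le> (\<integral>\<^sup>+t\<in>{a..b}. ennreal \<bar>g' t\<bar> \<partial>lebesgue)"
    by (rule ennreal_integral_le_nn_integral_abs)
  also have "\<dots> \<le> JM_length (kepler_V e) a b \<sigma>"
    unfolding JM_length_def
  proof (intro nn_integral_mono mult_right_mono)
    fix t
    show "ennreal \<bar>g' t\<bar> \<le> esqrt (2 * neg_potential (kepler_V e) (\<sigma> t)) * ennreal (norm (vector_derivative \<sigma> (at t)))"
    \<comment> \<open>At a collision \<open>damped_grad\<close> is 0, so the estimate holds even
      where the curve rests and the right side is \<infinity> * 0 = 0.\<close>
    proof (cases "\<sigma> t = 0")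
      case False
      have "\<bar>g' t\<bar> \<le> norm (damped_grad (\<sigma> t)) * norm (vector_derivative \<sigma> (at t))"
        unfolding g'_def by (rule Cauchy_Schwarz_ineq2)
      also have "\<dots> \<le> sqrt (2 * kepler_U e (\<sigma> t)) * norm (vector_derivative \<sigma> (at t))"
        using norm_damped_grad_le[OF False] by (intro mult_right_mono) auto
      finally show ?thesis
        using False kepler_U_pos[OF e False]
        by (simp add: esqrt_kepler_V[OF e] ennreal_mult[symmetric] ennreal_leI)
    qed (simp add: g'_def damped_grad_def)
  qed auto
  finally show ?thesis by (simp add: g_def)
qed

end

lemma action_fun_diff_le_JM_length:
  fixes e :: "'a::euclidean_space"
  assumes e: "norm e = 1" and "a \<le> b" "abs_continuous_curve a b \<sigma>"
  shows "ennreal (action_fun e (\<sigma> b) - action_fun e (\<sigma> a)) \<le> JM_length (kepler_V e) a b \<sigma>"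
proof (cases "JM_length (kepler_V e) a b \<sigma>")
  case (real r)
  let ?d = "action_fun e (\<sigma> b) - action_fun e (\<sigma> a)"
  have "?d \<le> r + \<epsilon>" if "\<epsilon> > 0" for \<epsilon>
  proof -
    \<comment> \<open>Damping with parameter \<eta> changes each end value by at most \<eta> pi / 2,
      so the two errors together are at most \<epsilon>.\<close>
    define \<eta> where "\<eta> = \<epsilon> / pi"
    have \<eta>: "\<eta> > 0" using that by (simp add: \<eta>_def)
    have "\<bar>\<eta> * arctan x\<bar> \<le> \<epsilon> / 2" for x
    proof -
      have "\<bar>arctan x\<bar> \<le> pi / 2" using arctan_bounded[of x] by linarith
      then have "\<eta> * \<bar>arctan x\<bar> \<le> \<eta> * (pi / 2)" using \<eta> by (intro mult_left_mono) auto
      moreover have "\<bar>\<eta> * arctan x\<bar> = \<eta> * \<bar>arctan x\<bar>" using \<eta> by (simp add: abs_mult)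
      moreover have "\<eta> * (pi / 2) = \<epsilon> / 2" by (simp add: \<eta>_def)
      ultimately show ?thesis by simp
    qed
    from this[of "action_fun e (\<sigma> b) / \<eta>"] this[of "action_fun e (\<sigma> a) / \<eta>"]
    have "?d - \<epsilon> \<le> damp \<eta> (action_fun e (\<sigma> b)) - damp \<eta> (action_fun e (\<sigma> a))"
      unfolding damp_def by linarith
    also have "\<dots> \<le> r"
      using damped_le_JM_length[OF e \<eta> assms(2,3)] real by (simp add: ennreal_le_iff)
    finally show ?thesis by simp
  qed
  then have "?d \<le> r" by (rule field_le_epsilon)
  then show ?thesis using real by (simp add: ennreal_leI)
qed simp

lemma JM_length_le_action:
  "JM_length V 0 T c \<le> action V T c"
  unfolding JM_length_def action_def
proof (intro nn_integral_mono mult_right_mono)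
  fix t
  define u v where "u = neg_potential V (c t)" and "v = norm (vector_derivative c (at t))"
  have v: "v \<ge> 0" by (simp add: v_def)
  have "esqrt (2 * u) * ennreal v \<le> ennreal (v\<^sup>2 / 2) + u"
  proof (cases u)
    case (real r)
    have "2 * u = ennreal (2 * r)" using real by (simp add: ennreal_mult)
    moreover have "esqrt (ennreal (2 * r)) = ennreal (sqrt (2 * r))"
      using real by (simp add: esqrt_def)
    ultimately have "esqrt (2 * u) * ennreal v = ennreal (sqrt (2 * r) * v)"
      using real v by (simp only:) (rule ennreal_mult[symmetric], auto)
    also have "\<dots> \<le> ennreal (v\<^sup>2 / 2 + r)"
    proof (rule ennreal_leI)
      have "0 \<le> (sqrt (2 * r) - v)\<^sup>2" by simp
      also have "\<dots> = 2 * r - 2 * (sqrt (2 * r) * v) + v\<^sup>2"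
        using real by (simp add: power2_diff)
      finally show "sqrt (2 * r) * v \<le> v\<^sup>2 / 2 + r" by simp
    qed
    finally show ?thesis using real v by simp
  qed simp
  then show "esqrt (2 * neg_potential V (c t)) * ennreal (norm (vector_derivative c (at t)))
      \<le> Lagrangian V (c t) (vector_derivative c (at t))"
    by (simp add: u_def v_def Lagrangian_def)
qed auto

subsection \<open>The collision trajectory\<close>

text \<open>The zero-energy fall into the collision and its reflection: \<open>action_fun e\<close> of the curve is the
  cube root \<open>collision_param\<close>, whose derivative is the Lagrangian along the curve.\<close>

definition collision_param :: "real \<Rightarrow> real" where
  "collision_param t = root 3 (3 / 4 * t - 1)"

definition collision_curve :: "'a::euclidean_space \<Rightarrow> real \<Rightarrow> 'a" where
  "collision_curve e t = (collision_param t * \<bar>collision_param t\<bar>) *\<^sub>R e"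

text \<open>On the line of e the gradient flow of S is x' = 1 / (2 sqrt |x|). In terms of y = S,
  where x = y |y|, this reads y' = 1 / (4 y^2), so y^3 grows at the rate 3/4: from -1 at time 0
  through 0 at 4/3 to 1 at 8/3.\<close>

lemma collision_param_cube: "collision_param t ^ 3 = 3 / 4 * t - 1"
  by (simp add: collision_param_def odd_real_root_pow)

lemma collision_param_mono: "s \<le> t \<Longrightarrow> collision_param s \<le> collision_param t"
  by (simp add: collision_param_def)

lemma collision_param_ends: "collision_param 0 = - 1" "collision_param (8 / 3) = 1"
  by (simp_all add: collision_param_def real_root_minus)

lemma collision_param_eq_0_iff: "collision_param t = 0 \<longleftrightarrow> t = 4 / 3"
  by (auto simp: collision_param_def)

lemma collision_param_has_derivative:
  assumes "t \<noteq> 4 / 3"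
  shows "(collision_param has_field_derivative 1 / (4 * (collision_param t)\<^sup>2)) (at t)"
proof -
  have "(root 3 has_field_derivative inverse (real 3 * root 3 (3 / 4 * t - 1) ^ (3 - Suc 0))) (at (3 / 4 * t - 1))"
    using assms by (intro DERIV_odd_real_root) auto
  then have "((\<lambda>t. root 3 (3 / 4 * t - 1)) has_field_derivative
      inverse (real 3 * root 3 (3 / 4 * t - 1) ^ (3 - Suc 0)) * (3 / 4)) (at t)"
    by (rule DERIV_chain2) (auto intro!: derivative_eq_intros)
  moreover have "inverse (real 3 * root 3 (3 / 4 * t - 1) ^ (3 - Suc 0)) * (3 / 4) = 1 / (4 * (collision_param t)\<^sup>2)"
    by (simp add: collision_param_def power2_eq_square field_simps)
  moreover have "collision_param = (\<lambda>t. root 3 (3 / 4 * t - 1))"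
    by (rule ext) (rule collision_param_def)
  ultimately show ?thesis by metis
qed

text \<open>The right side minus the left side is the integral of (|x| - \<mu>)^2 / \<mu> from u to
  v. For u and v the values of \<open>collision_param\<close> at two times, the cubes are affine in
  time, so a displacement is bounded by a small multiple of the increment of the parameter plus a
  multiple of the elapsed time.\<close>

lemma square_increment_le:
  fixes u v \<mu> :: real
  assumes "u \<le> v" "\<mu> > 0"
  shows "v * \<bar>v\<bar> - u * \<bar>u\<bar> \<le> \<mu> * (v - u) + (v ^ 3 - u ^ 3) / (3 * \<mu>)"
proof -
  define h where "h x = \<mu> * x + x ^ 3 / (3 * \<mu>) - x * \<bar>x\<bar>" for x
  have *: "h x \<le> h y" if "0 \<le> x" "x \<le> y" for x y
  proof -
    have "h y - h x = (y - x) / \<mu> * ((\<mu> - (x + y) / 2)\<^sup>2 + (y - x)\<^sup>2 / 12)"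
      using that \<open>\<mu> > 0\<close> by (simp add: h_def field_simps power2_eq_square power3_eq_cube)
    also have "\<dots> \<ge> 0" using that \<open>\<mu> > 0\<close> by simp
    finally show ?thesis by simp
  qed
  have odd: "h (- x) = - h x" for x by (simp add: h_def field_simps)
  have "h u \<le> h v"
  proof (cases "u \<ge> 0")
    case True
    then show ?thesis using * assms by simp
  next
    case u: False
    show ?thesis
    proof (cases "v \<le> 0")
      case True
      then show ?thesis using *[of "- v" "- u"] assms by (simp add: odd)
    next
      case False
      have "h 0 = 0" by (simp add: h_def)
      then show ?thesis using *[of 0 v] *[of 0 "- u"] u False by (simp add: odd)
    qed
  qed
  then show ?thesis by (simp add: h_def diff_divide_distrib right_diff_distrib)
qed

lemma mult_abs_mono:
  fixes u v :: real
  assumes "u \<le> v"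
  shows "u * \<bar>u\<bar> \<le> v * \<bar>v\<bar>"
proof (cases "0 \<le> u")
  case True
  then show ?thesis using assms by (intro mult_mono) auto
next
  case u: False
  show ?thesis
  proof (cases "0 \<le> v")
    case True
    then have "0 \<le> v * \<bar>v\<bar>" by simp
    moreover have "u * \<bar>u\<bar> \<le> 0" using u by (intro mult_nonpos_nonneg) auto
    ultimately show ?thesis by linarith
  next
    case False
    then have "(- v) * (- v) \<le> (- u) * (- u)" using assms by (intro mult_mono) auto
    then show ?thesis using u False by simp
  qed
qed

lemma abs_continuous_collision_curve:
  fixes e :: "'a::euclidean_space"
  assumes "norm e = 1"
  shows "abs_continuous_curve 0 (8 / 3) (collision_curve e)"
  unfolding abs_continuous_curve_def
proof (intro allI impI)
  fix \<epsilon> :: real assume "\<epsilon> > 0"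
  define \<mu> where "\<mu> = \<epsilon> / 4"
  have \<mu>: "\<mu> > 0" using \<open>\<epsilon> > 0\<close> by (simp add: \<mu>_def)
  have "(\<Sum>I\<in>D. norm (increment (collision_curve e) I)) < \<epsilon>"
    if D: "D division_of \<Union>D" "\<Union>D \<subseteq> {0..8 / 3}" "(\<Sum>I\<in>D. Sup I - Inf I) < 2 * \<mu> * \<epsilon>" for D
  proof -
    have "norm (increment (collision_curve e) I) \<le> \<mu> * increment collision_param I + (Sup I - Inf I) / (4 * \<mu>)"
      if "I \<in> D" for I
    proof -
      from division_memberD[OF D(1) that] obtain s t where I: "I = {s..t}" "s \<le> t" by blast
      define u v where "u = collision_param s" and "v = collision_param t"
      have uv: "u \<le> v" using I(2) by (simp add: u_def v_def collision_param_mono)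
      have "v ^ 3 - u ^ 3 = 3 / 4 * (t - s)"
        by (simp add: u_def v_def collision_param_cube algebra_simps)
      then have "(v ^ 3 - u ^ 3) / (3 * \<mu>) = 3 / 4 * (t - s) / (3 * \<mu>)" by (simp only:)
      with square_increment_le[OF uv \<mu>]
      have "v * \<bar>v\<bar> - u * \<bar>u\<bar> \<le> \<mu> * (v - u) + 3 / 4 * (t - s) / (3 * \<mu>)" by (simp only:)
      also have "3 / 4 * (t - s) / (3 * \<mu>) = (t - s) / (4 * \<mu>)" using \<mu> by (simp add: field_simps)
      finally have "v * \<bar>v\<bar> - u * \<bar>u\<bar> \<le> \<mu> * (v - u) + (t - s) / (4 * \<mu>)" .
      moreover have "u * \<bar>u\<bar> \<le> v * \<bar>v\<bar>"
        using uv by (rule mult_abs_mono)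
      moreover have "collision_curve e t - collision_curve e s = (v * \<bar>v\<bar> - u * \<bar>u\<bar>) *\<^sub>R e"
        by (simp add: collision_curve_def u_def v_def scaleR_diff_left)
      ultimately show ?thesis using I assms by (simp add: u_def v_def)
    qed
    then have "(\<Sum>I\<in>D. norm (increment (collision_curve e) I))
        \<le> (\<Sum>I\<in>D. \<mu> * increment collision_param I + (Sup I - Inf I) / (4 * \<mu>))"
      by (rule sum_mono)
    also have "\<dots> = \<mu> * (\<Sum>I\<in>D. increment collision_param I) + (\<Sum>I\<in>D. Sup I - Inf I) / (4 * \<mu>)"
      by (simp only: sum.distrib sum_distrib_left sum_divide_distrib)
    also have "(\<Sum>I\<in>D. increment collision_param I) \<le> collision_param (8 / 3) - collision_param 0"
      using D(1,2) by (intro sum_increment_mono_le) (auto intro!: mono_onI collision_param_mono)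
    also have "\<dots> = 2" by (simp add: collision_param_ends)
    also have "(\<Sum>I\<in>D. Sup I - Inf I) / (4 * \<mu>) < 2 * \<mu> * \<epsilon> / (4 * \<mu>)"
      using D(3) \<mu> by (intro divide_strict_right_mono) auto
    finally show ?thesis using \<mu> by (simp add: \<mu>_def)
  qed
  then show "\<exists>\<delta>>0. \<forall>D. D division_of \<Union>D \<and> \<Union>D \<subseteq> {0..8 / 3} \<and> (\<Sum>I\<in>D. Sup I - Inf I) < \<delta>
        \<longrightarrow> (\<Sum>I\<in>D. norm (increment (collision_curve e) I)) < \<epsilon>"
    using \<mu> \<open>\<epsilon> > 0\<close> by (intro exI[of _ "2 * \<mu> * \<epsilon>"]) auto
qed

lemma Lagrangian_collision_curve:
  fixes e :: "'a::euclidean_space"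
  assumes e: "norm e = 1" and t: "t \<noteq> 4 / 3"
  shows "Lagrangian (kepler_V e) (collision_curve e t) (vector_derivative (collision_curve e) (at t))
    = ennreal (1 / (4 * (collision_param t)\<^sup>2))"
proof -
  define y where "y = collision_param t"
  have y: "y \<noteq> 0" using t by (simp add: y_def collision_param_eq_0_iff)
  have d: "(collision_param has_field_derivative 1 / (4 * y\<^sup>2)) (at t)"
    unfolding y_def by (rule collision_param_has_derivative[OF t])
  have "(norm has_derivative (\<lambda>h. h * sgn y)) (at y)"
    using has_derivative_norm[OF y] by (simp only: inner_real_def mult.commute)
  then have "(norm has_field_derivative sgn y) (at (collision_param t))"
    unfolding has_field_derivative_def y_def by (simp only: mult_commute_abs)
  moreover have "(norm :: real \<Rightarrow> real) = (\<lambda>x. \<bar>x\<bar>)" by (rule ext) simp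
  ultimately have "((\<lambda>x::real. \<bar>x\<bar>) has_field_derivative sgn y) (at (collision_param t))"
    by (simp only:)
  from DERIV_chain2[OF this d]
  have "((\<lambda>t. \<bar>collision_param t\<bar>) has_field_derivative sgn y * (1 / (4 * y\<^sup>2))) (at t)" .
  from DERIV_mult[OF d this] have "((\<lambda>t. collision_param t * \<bar>collision_param t\<bar>) has_field_derivative
      1 / (4 * y\<^sup>2) * \<bar>y\<bar> + sgn y * (1 / (4 * y\<^sup>2)) * y) (at t)"
    unfolding y_def .
  moreover have "1 / (4 * y\<^sup>2) * \<bar>y\<bar> + sgn y * (1 / (4 * y\<^sup>2)) * y = 1 / (2 * \<bar>y\<bar>)"
    using y by (auto simp: field_simps power2_eq_square abs_if sgn_if)
  ultimately have "((\<lambda>t. collision_param t * \<bar>collision_param t\<bar>) has_real_derivative 1 / (2 * \<bar>y\<bar>)) (at t)"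
    by simp
  then have "(collision_curve e has_vector_derivative (1 / (2 * \<bar>y\<bar>)) *\<^sub>R e) (at t)"
    unfolding collision_curve_def[abs_def] by (rule has_vector_derivative_scaleR[OF _ has_vector_derivative_const, simplified])
  then have vd: "vector_derivative (collision_curve e) (at t) = (1 / (2 * \<bar>y\<bar>)) *\<^sub>R e"
    by (rule vector_derivative_at)
  have c: "collision_curve e t = (y * \<bar>y\<bar>) *\<^sub>R e" by (simp add: collision_curve_def y_def)
  have "e \<noteq> 0" using e by auto
  then have c0: "collision_curve e t \<noteq> 0" using y c by simp
  have nc: "norm (collision_curve e t) = y\<^sup>2" "(collision_curve e t \<bullet> e)\<^sup>2 = y ^ 4"
    using e by (simp_all add: c dot_square_norm power2_eq_square eval_nat_numeral abs_mult)
  have "kepler_U e (collision_curve e t) = 1 / (8 * y\<^sup>2)"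
    unfolding kepler_U_def nc using y by (simp add: field_simps eval_nat_numeral)
  moreover have "(norm (vector_derivative (collision_curve e) (at t)))\<^sup>2 / 2 = 1 / (8 * y\<^sup>2)"
    unfolding vd using e by (simp add: power_divide power_mult_distrib)
  ultimately have "Lagrangian (kepler_V e) (collision_curve e t) (vector_derivative (collision_curve e) (at t))
     = ennreal (1 / (8 * y\<^sup>2)) + ennreal (1 / (8 * y\<^sup>2))"
    using c0 by (simp add: Lagrangian_def neg_potential_kepler_V[OF e])
  also have "\<dots> = ennreal (1 / (8 * y\<^sup>2) + 1 / (8 * y\<^sup>2))" by (rule ennreal_plus[symmetric]) auto
  finally show ?thesis by (simp add: y_def field_simps)
qed

lemma action_collision_curve:
  fixes e :: "'a::euclidean_space"
  assumes e: "norm e = 1"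
  shows "action (kepler_V e) (8 / 3) (collision_curve e) = ennreal 2"
proof -
  let ?f = "\<lambda>t. 1 / (4 * (collision_param t)\<^sup>2)"
  have "(?f has_integral (collision_param (8 / 3) - collision_param 0)) {0..8 / 3}"
  proof (rule fundamental_theorem_of_calculus_interior_strong[of "{4 / 3}"])
    show "continuous_on {0..8 / 3} collision_param"
      unfolding collision_param_def[abs_def] by (intro continuous_intros)
    show "(collision_param has_vector_derivative ?f t) (at t)" if "t \<in> {0<..<8 / 3} - {4 / 3}" for t
      using collision_param_has_derivative[of t] that
      by (simp add: has_real_derivative_iff_has_vector_derivative)
  qed auto
  then have "(?f has_integral 2) {0..8 / 3}" by (simp add: collision_param_ends)
  then have "integral\<^sup>N lborel (\<lambda>t. ennreal (?f t) * indicator {0..8 / 3} t) = ennreal 2"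
    by (intro nn_integral_has_integral_lebesgue') auto
  then have "(\<integral>\<^sup>+t\<in>{0..8 / 3}. ennreal (?f t) \<partial>lebesgue) = ennreal 2"
    by (subst nn_integral_completion) (auto simp: collision_param_def)
  moreover have "AE t in lebesgue. t \<noteq> (4 / 3 :: real)"
    by (rule AE_completion) (rule AE_lborel_singleton)
  then have "action (kepler_V e) (8 / 3) (collision_curve e) = (\<integral>\<^sup>+t\<in>{0..8 / 3}. ennreal (?f t) \<partial>lebesgue)"
    unfolding action_def
    by (intro nn_integral_cong_AE, elim eventually_mono) (simp add: Lagrangian_collision_curve[OF e])
  ultimately show ?thesis by simp
qed

lemma collision_curve_ends: "collision_curve e 0 = - e" "collision_curve e (8 / 3) = e"
  by (simp_all add: collision_curve_def collision_param_ends)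

lemma action_fun_ends:
  assumes "norm e = 1"
  shows "action_fun e e = 1" "action_fun e (- e) = - 1"
  using assms by (simp_all add: action_fun_def dot_square_norm)

lemma interior_collision_collision_curve:
  assumes e: "norm e = 1"
  shows "interior_collision_point (kepler_V e) 0 (8 / 3) (collision_curve e) 0"
proof -
  have "collision_curve e (4 / 3) = 0"
    by (simp add: collision_curve_def collision_param_def)
  then have "0 \<in> collision_curve e ` {0..8 / 3}" by (intro image_eqI[of _ _ "4 / 3"]) auto
  moreover have "e \<noteq> 0" using e by auto
  ultimately show ?thesis
    by (simp add: interior_collision_point_def collision_curve_ends collision_point_def
        neg_potential_kepler_V[OF e])
qed

lemma minimizing_collision_curve:
  fixes e :: "'a::euclidean_space"
  assumes e: "norm e = 1"
  shows "minimizing_JM_geodesic (kepler_V e) 0 (8 / 3) (collision_curve e)"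
    and "action_minimizer (kepler_V e) (- e) e (8 / 3) (collision_curve e)"
proof -
  have low: "ennreal 2 \<le> JM_length (kepler_V e) a b \<sigma>"
    if "a \<le> b" "abs_continuous_curve a b \<sigma>" "\<sigma> a = - e" "\<sigma> b = e" for a b \<sigma>
    using action_fun_diff_le_JM_length[OF e that(1,2)] that(3,4) action_fun_ends[OF e] by simp
  have JM: "JM_length (kepler_V e) 0 (8 / 3) (collision_curve e) \<le> ennreal 2"
    using JM_length_le_action action_collision_curve[OF e] by metis
  show "minimizing_JM_geodesic (kepler_V e) 0 (8 / 3) (collision_curve e)"
    unfolding minimizing_JM_geodesic_def collision_curve_ends
  proof (intro conjI allI impI)
    show "JM_length (kepler_V e) 0 (8 / 3) (collision_curve e) < \<infinity>"
      using JM by (rule le_less_trans) simp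
    fix a' b' \<sigma>
    assume "a' < b' \<and> abs_continuous_curve a' b' \<sigma> \<and> \<sigma> a' = - e \<and> \<sigma> b' = e"
    then show "JM_length (kepler_V e) 0 (8 / 3) (collision_curve e) \<le> JM_length (kepler_V e) a' b' \<sigma>"
      using JM low[of a' b' \<sigma>] by (meson less_imp_le order_trans)
  qed (use abs_continuous_collision_curve[OF e] in auto)
  show "action_minimizer (kepler_V e) (- e) e (8 / 3) (collision_curve e)"
    unfolding action_minimizer_def collision_curve_ends action_collision_curve[OF e]
  proof (intro conjI allI impI)
    fix \<sigma> assume "abs_continuous_curve 0 (8 / 3) \<sigma> \<and> \<sigma> 0 = - e \<and> \<sigma> (8 / 3) = e"
    then have "ennreal 2 \<le> JM_length (kepler_V e) 0 (8 / 3) \<sigma>" by (intro low) auto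
    then show "ennreal 2 \<le> action (kepler_V e) (8 / 3) \<sigma>"
      using JM_length_le_action order_trans by blast
  qed (use abs_continuous_collision_curve[OF e] in auto)
qed

theorem theorem3:
  shows "\<exists>V :: real ^ 'n \<Rightarrow> ereal.
           continuous_on UNIV V \<and>
           (\<forall>q. V q < 0) \<and>
           (\<exists>\<alpha>>0. homogeneous_of_degree (- \<alpha>) V) \<and>
           smooth_away_from_0 V \<and>
           \<not> JM_Marchal_lemma V \<and>
           \<not> Marchal_lemma V"
proof -
  obtain e :: "real ^ 'n" where e: "norm e = 1" using vector_choose_size[of 1] by auto
  have "\<not> JM_Marchal_lemma (kepler_V e)"
    using minimizing_collision_curve(1)[OF e] interior_collision_collision_curve[OF e]
    unfolding JM_Marchal_lemma_def by blast
  moreover have "\<not> Marchal_lemma (kepler_V e)"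
    using minimizing_collision_curve(2)[OF e] interior_collision_collision_curve[OF e]
    unfolding Marchal_lemma_def by (metis zero_less_divide_iff zero_less_numeral)
  ultimately show ?thesis
    using continuous_kepler_V[OF e] kepler_V_neg[OF e] homogeneous_kepler_V[OF e] smooth_kepler_V[OF e]
    by (intro exI[of _ "kepler_V e"] conjI allI exI[of _ 1]) auto
qed

end
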